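(* For every $x,y\in\Omega$, the curve $$\gamma^\Delta_{x,y}(t)=\mathrm{Exp}_\Delta\bigl((1-t)\mathrm{Log}_\Delta(x)+t\,\mathrm{Log}_\Delta(y)\bigr),\qquad 0\le t\le1,$$ is the unique affinely parametrized $\nabla^\Delta$-geodesic joining $x$ to $y$ on $[0,1]$. It is also the unique $g^\Delta$-geodesic segment from $x$ to $y$. Consequently, $x\odot_\Delta y=\gamma^\Delta_{x,y}(1/2)$ is the midpoint of this $g^\Delta$-geodesic segment. Moreover, for $0\le t\le 1$, $$d_\Delta(x,\gamma^\Delta_{x,y}(t))=t\,d_\Delta(x,y),\qquad d_\Delta(y,\gamma^\Delta_{x,y}(t))=(1-t)\,d_\Delta(x,y).$$ In particular, $d_\Delta(x,x\odot_\Delta y)=d_\Delta(y,x\odot_\Delta y)=\frac12d_\Delta(x,y)$.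
   Context: Let $V\subset \mathrm{Sym}(3,\mathbb{R})$ be the 5-dimensional space of real symmetric $3\times3$ matrices whose $(1,2)$ and $(2,1)$ entries are $0$, and let $\Omega\subset V$ be the open cone of positive definite matrices in $V$. Each $x\in\Omega$ has a unique lower triangular Cholesky factor $T_x$ with positive diagonal and $x=T_xT_x^{\top}$. For $v\in V$ let $\underline{v}$ be the unique lower triangular matrix with $v=\underline v+\underline v^{\top}$. The clan product on $V$ is $u\Delta w=\underline u\,w+w\,\underline u^{\top}$, $L_u(w)=u\Delta w$, and $Q_\Delta(u,v)=\mathrm{tr}(L_{u\Delta v})$, an inner product on $V$. The clan exponential $\mathrm{Exp}_\Delta:V\to\Omega$, $\mathrm{Exp}_\Delta(v)=\exp(\underline v)\exp(\underline v)^{\top}$, is a diffeomorphism with inverse $\mathrm{Log}_\Delta(x)=\log(T_x)+\log(T_x)^{\top}$ (principal logarithm). The Riemannian metric $g^\Delta$ on $\Omega$ is $g^\Delta_x(u,v)=Q_\Delta\bigl((d\mathrm{Log}_\Delta)_xu,(d\mathrm{Log}_\Delta)_xv\bigr)$, with Riemannian distance $d_\Delta$. With $D^V$ the standard flat connection on $V$, $\nabla^\Delta_UW:=(\mathrm{Exp}_\Delta)_*\bigl(D^V_{(\mathrm{Log}_\Delta)_*U}(\mathrm{Log}_\Delta)_*W\bigr)$. The Log-Vinberg mean is $x\odot_\Delta y:=\gamma^\Delta_{x,y}(1/2)$. *)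

theory Defs
  imports "HOL-Analysis.Analysis"
begin

section \<open>Matrices\<close>

text \<open>The library orders the index type \<open>3\<close> as \<open>3 = 0 < 1 < 2\<close>, hence the explicit entries here.\<close>

definition lower_triangular :: "real^3^3 \<Rightarrow> bool" where
  "lower_triangular A \<longleftrightarrow> A$1$2 = 0 \<and> A$1$3 = 0 \<and> A$2$3 = 0"

definition positive_definite :: "real^3^3 \<Rightarrow> bool" where
  "positive_definite A \<longleftrightarrow> transpose A = A \<and> (\<forall>v. v \<noteq> 0 \<longrightarrow> v \<bullet> (A *v v) > 0)"

text \<open>The class instances \<open>*\<close> and \<open>^\<close> on vectors are componentwise, so powers and the
  exponential have to be built from \<open>**\<close>.\<close>

definition mat_power :: "real^3^3 \<Rightarrow> nat \<Rightarrow> real^3^3" where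
  "mat_power A n = (((**) A) ^^ n) (mat 1)"

definition mat_exp :: "real^3^3 \<Rightarrow> real^3^3" where
  "mat_exp A = (\<Sum>n. (1 / fact n) *\<^sub>R mat_power A n)"

definition complex_eigenvalue :: "real^3^3 \<Rightarrow> complex \<Rightarrow> bool" where
  "complex_eigenvalue A z \<longleftrightarrow> det (mat z - map_matrix complex_of_real A) = 0"

text \<open>Principal logarithm: the logarithm whose spectrum lies in the strip
  \<open>{z. \<bar>Im z\<bar> < pi}\<close>.  The principal logarithm of a real matrix is real.\<close>

definition mat_log :: "real^3^3 \<Rightarrow> real^3^3" where
  "mat_log A = (THE X. mat_exp X = A \<and> (\<forall>z. complex_eigenvalue X z \<longrightarrow> \<bar>Im z\<bar> < pi))"

section \<open>The Vinberg cone and its clan structure\<close>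

definition V :: "(real^3^3) set" where
  "V = {A. transpose A = A \<and> A$1$2 = 0 \<and> A$2$1 = 0}"

definition Omega :: "(real^3^3) set" where
  "Omega = {A \<in> V. positive_definite A}"

definition cholesky :: "real^3^3 \<Rightarrow> real^3^3" where
  "cholesky x = (THE T. lower_triangular T \<and> (\<forall>i. T$i$i > 0) \<and> x = T ** transpose T)"

definition lower_half :: "real^3^3 \<Rightarrow> real^3^3" where
  "lower_half v = (THE L. lower_triangular L \<and> v = L + transpose L)"

definition clan :: "real^3^3 \<Rightarrow> real^3^3 \<Rightarrow> real^3^3" where
  "clan u w = lower_half u ** w + w ** transpose (lower_half u)"

text \<open>\<open>axis i (axis j 1)\<close> is the matrix unit with entry 1 in row \<open>i\<close>, column \<open>j\<close>.\<close>

definition V_basis :: "(real^3^3) set" where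
  "V_basis = {axis 1 (axis 1 1), axis 2 (axis 2 1), axis 3 (axis 3 1),
     axis 3 (axis 1 1) + axis 1 (axis 3 1), axis 3 (axis 2 1) + axis 2 (axis 3 1)}"

lemma independent_V_basis: "independent V_basis"
proof -
  have ax: "axis i (axis j 1) $ k $ l = (if k = i \<and> l = j then 1 else 0)"
    for i j k l :: 3 by (auto simp: axis_def)
  have "pairwise orthogonal V_basis"
    unfolding V_basis_def pairwise_insert orthogonal_def
    by (auto simp: inner_axis_axis inner_add_left inner_add_right)
  moreover have "0 \<notin> V_basis"
    by (simp add: V_basis_def vec_eq_iff forall_3 ax)
  ultimately show ?thesis by (rule pairwise_orthogonal_independent)
qed

lemma span_V_basis: "span V_basis = V"
proof
  have ax: "axis i (axis j 1) $ k $ l = (if k = i \<and> l = j then 1 else 0)"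
    for i j k l :: 3 by (auto simp: axis_def)
  have "subspace V"
    by (simp add: subspace_def V_def transpose_def vec_eq_iff)
  moreover have "V_basis \<subseteq> V"
    by (simp add: V_basis_def V_def transpose_def vec_eq_iff forall_3) (simp add: axis_def)
  ultimately show "span V_basis \<subseteq> V" by (rule span_minimal[rotated])
  show "V \<subseteq> span V_basis"
  proof
    fix A assume A: "A \<in> V"
    have A0: "A$1$2 = 0" "A$2$1 = 0"
      using A by (simp_all add: V_def)
    have "transpose A $ i $ j = A $ i $ j" for i j
      using A by (simp add: V_def)
    from this[of 3 1] this[of 3 2] have At: "A$1$3 = A$3$1" "A$2$3 = A$3$2"
      by (simp_all add: transpose_def)
    have "A = A$1$1 *\<^sub>R axis 1 (axis 1 1) + A$2$2 *\<^sub>R axis 2 (axis 2 1)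
        + A$3$3 *\<^sub>R axis 3 (axis 3 1)
        + A$3$1 *\<^sub>R (axis 3 (axis 1 1) + axis 1 (axis 3 1))
        + A$3$2 *\<^sub>R (axis 3 (axis 2 1) + axis 2 (axis 3 1))"
      by (simp add: vec_eq_iff forall_3 ax A0 At)
    also have "\<dots> \<in> span V_basis"
      by (intro span_add span_scale span_base) (simp_all add: V_basis_def)
    finally show "A \<in> span V_basis" .
  qed
qed

text \<open>Trace of a linear endomorphism of \<open>span B\<close>, for a finite basis \<open>B\<close>: the sum of the
  diagonal coefficients of its matrix with respect to \<open>B\<close>.\<close>

definition trace_wrt :: "'a::real_vector set \<Rightarrow> ('a \<Rightarrow> 'a) \<Rightarrow> real" where
  "trace_wrt B f = (\<Sum>b\<in>B. representation B (f b) b)"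

definition Q_Delta :: "real^3^3 \<Rightarrow> real^3^3 \<Rightarrow> real" where
  "Q_Delta u v = trace_wrt V_basis (clan (clan u v))"

definition Exp_Delta :: "real^3^3 \<Rightarrow> real^3^3" where
  "Exp_Delta v = mat_exp (lower_half v) ** transpose (mat_exp (lower_half v))"

definition Log_Delta :: "real^3^3 \<Rightarrow> real^3^3" where
  "Log_Delta x = mat_log (cholesky x) + transpose (mat_log (cholesky x))"

section \<open>Differential geometry on the cone\<close>

text \<open>\<open>Omega\<close> is open in the proper subspace \<open>V\<close>.  A derivative within \<open>V\<close> or \<open>Omega\<close> is
  determined only on directions in \<open>V\<close>, so the differentials below are meaningful only there;
  all tangent vectors to which they are applied lie in \<open>V\<close>.\<close>

definition dLog_Delta :: "real^3^3 \<Rightarrow> real^3^3 \<Rightarrow> real^3^3" where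
  "dLog_Delta x = frechet_derivative Log_Delta (at x within Omega)"

definition dExp_Delta :: "real^3^3 \<Rightarrow> real^3^3 \<Rightarrow> real^3^3" where
  "dExp_Delta v = frechet_derivative Exp_Delta (at v within V)"

definition g_Delta :: "real^3^3 \<Rightarrow> real^3^3 \<Rightarrow> real^3^3 \<Rightarrow> real" where
  "g_Delta x u v = Q_Delta (dLog_Delta x u) (dLog_Delta x v)"

subsection \<open>Length and Riemannian distance\<close>

definition C1_curve_on :: "real \<Rightarrow> real \<Rightarrow> (real \<Rightarrow> real^3^3) \<Rightarrow> bool" where
  "C1_curve_on a b c \<longleftrightarrow> (\<exists>c'. continuous_on {a..b} c' \<and>
     (\<forall>t\<in>{a..b}. (c has_vector_derivative c' t) (at t within {a..b})))"

definition piecewise_C1_curve :: "(real \<Rightarrow> real^3^3) \<Rightarrow> bool" where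
  "piecewise_C1_curve c \<longleftrightarrow> (\<exists>n (\<tau>::nat \<Rightarrow> real). \<tau> 0 = 0 \<and> \<tau> n = 1 \<and>
     (\<forall>i<n. \<tau> i < \<tau> (Suc i) \<and> C1_curve_on (\<tau> i) (\<tau> (Suc i)) c))"

definition curve_length :: "(real \<Rightarrow> real^3^3) \<Rightarrow> real \<Rightarrow> real \<Rightarrow> real" where
  "curve_length c a b = integral {a..b} (\<lambda>t.
     let v = vector_derivative c (at t within {a..b}) in sqrt (g_Delta (c t) v v))"

definition d_Delta :: "real^3^3 \<Rightarrow> real^3^3 \<Rightarrow> real" where
  "d_Delta x y = Inf {curve_length c 0 1 | c.
     piecewise_C1_curve c \<and> c ` {0..1} \<subseteq> Omega \<and> c 0 = x \<and> c 1 = y}"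

subsection \<open>Connections and geodesics\<close>

text \<open>The connection transported from the flat connection \<open>D_A B (v) = dB_v (A v)\<close> on \<open>V\<close>,
  acting on vector fields \<open>U\<close>, \<open>W\<close> on \<open>Omega\<close>.  The field \<open>(Log_Delta)_* W\<close> is
  \<open>v \<mapsto> dLog_Delta (Exp_Delta v) (W (Exp_Delta v))\<close>.\<close>

definition push_Log :: "(real^3^3 \<Rightarrow> real^3^3) \<Rightarrow> real^3^3 \<Rightarrow> real^3^3" where
  "push_Log W v = dLog_Delta (Exp_Delta v) (W (Exp_Delta v))"

definition push_Exp :: "(real^3^3 \<Rightarrow> real^3^3) \<Rightarrow> real^3^3 \<Rightarrow> real^3^3" where
  "push_Exp A x = dExp_Delta (Log_Delta x) (A (Log_Delta x))"

definition D_flat ::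
  "(real^3^3 \<Rightarrow> real^3^3) \<Rightarrow> (real^3^3 \<Rightarrow> real^3^3) \<Rightarrow> real^3^3 \<Rightarrow> real^3^3" where
  "D_flat A B v = frechet_derivative B (at v within V) (A v)"

definition nabla_Delta ::
  "(real^3^3 \<Rightarrow> real^3^3) \<Rightarrow> (real^3^3 \<Rightarrow> real^3^3) \<Rightarrow> real^3^3 \<Rightarrow> real^3^3" where
  "nabla_Delta U W = push_Exp (D_flat (push_Log U) (push_Log W))"

text \<open>Christoffel symbols in the linear coordinates of \<open>V\<close>: a connection \<open>\<nabla>\<close> on \<open>Omega\<close> is
  \<open>(\<nabla>_U W)(x) = dW_x (U x) + \<Gamma> x (U x) (W x)\<close>, so \<open>\<Gamma> x u w\<close> is the value at \<open>x\<close> of \<open>\<nabla>\<close> on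
  the constant fields \<open>u\<close>, \<open>w\<close>.\<close>

definition Gamma_nabla :: "real^3^3 \<Rightarrow> real^3^3 \<Rightarrow> real^3^3 \<Rightarrow> real^3^3" where
  "Gamma_nabla x u w = nabla_Delta (\<lambda>_. u) (\<lambda>_. w) x"

text \<open>The Levi-Civita connection of \<open>g_Delta\<close>, in terms of its Christoffel symbols: it is the
  torsion-free metric connection.  Constant fields commute, so torsion-freeness is symmetry of
  \<open>\<Gamma> x\<close>; metric compatibility is \<open>z g(u, w) = g(\<nabla>_z u, w) + g(u, \<nabla>_z w)\<close> on constant fields.
  These conditions determine \<open>\<Gamma> x u w\<close> for \<open>x \<in> Omega\<close>, \<open>u, w \<in> V\<close>, so the choice made by
  \<open>SOME\<close> is irrelevant there.\<close>

definition levi_civita :: "(real^3^3 \<Rightarrow> real^3^3 \<Rightarrow> real^3^3 \<Rightarrow> real^3^3) \<Rightarrow> bool" where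
  "levi_civita \<Gamma> \<longleftrightarrow> (\<forall>x\<in>Omega. \<forall>u\<in>V. \<forall>w\<in>V. \<forall>z\<in>V.
     \<Gamma> x u w \<in> V \<and>
     (\<forall>a b. \<Gamma> x (a *\<^sub>R u + b *\<^sub>R w) z = a *\<^sub>R \<Gamma> x u z + b *\<^sub>R \<Gamma> x w z) \<and>
     \<Gamma> x u w = \<Gamma> x w u \<and>
     frechet_derivative (\<lambda>p. g_Delta p u w) (at x within Omega) z
       = g_Delta x (\<Gamma> x z u) w + g_Delta x u (\<Gamma> x z w))"

definition Gamma_LC :: "real^3^3 \<Rightarrow> real^3^3 \<Rightarrow> real^3^3 \<Rightarrow> real^3^3" where
  "Gamma_LC = (SOME \<Gamma>. levi_civita \<Gamma>)"

text \<open>Affinely parametrized geodesic on \<open>{0..1}\<close> from \<open>x\<close> to \<open>y\<close>: a solution of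
  \<open>c'' + \<Gamma> c c' c' = 0\<close> (one-sided derivatives at the endpoints).\<close>

definition geodesic ::
  "(real^3^3 \<Rightarrow> real^3^3 \<Rightarrow> real^3^3 \<Rightarrow> real^3^3) \<Rightarrow> real^3^3 \<Rightarrow> real^3^3 \<Rightarrow>
   (real \<Rightarrow> real^3^3) \<Rightarrow> bool" where
  "geodesic \<Gamma> x y c \<longleftrightarrow> c ` {0..1} \<subseteq> Omega \<and> c 0 = x \<and> c 1 = y \<and>
     (\<exists>c' c''. \<forall>t\<in>{0..1}.
        (c has_vector_derivative c' t) (at t within {0..1}) \<and>
        (c' has_vector_derivative c'' t) (at t within {0..1}) \<and>
        c'' t + \<Gamma> (c t) (c' t) (c' t) = 0)"

definition unique_geodesic ::
  "(real^3^3 \<Rightarrow> real^3^3 \<Rightarrow> real^3^3 \<Rightarrow> real^3^3) \<Rightarrow> real^3^3 \<Rightarrow> real^3^3 \<Rightarrow>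
   (real \<Rightarrow> real^3^3) \<Rightarrow> bool" where
  "unique_geodesic \<Gamma> x y c \<longleftrightarrow> geodesic \<Gamma> x y c \<and>
     (\<forall>b. geodesic \<Gamma> x y b \<longrightarrow> (\<forall>t\<in>{0..1}. b t = c t))"

text \<open>A point of the curve that divides it into two arcs of equal length.\<close>

definition midpoint_of_curve :: "(real \<Rightarrow> real^3^3) \<Rightarrow> real^3^3 \<Rightarrow> bool" where
  "midpoint_of_curve c m \<longleftrightarrow>
     (\<exists>s\<in>{0..1}. c s = m \<and> curve_length c 0 s = curve_length c s 1)"

section \<open>The Log-Vinberg mean\<close>

definition gamma_Delta :: "real^3^3 \<Rightarrow> real^3^3 \<Rightarrow> real \<Rightarrow> real^3^3" where
  "gamma_Delta x y t = Exp_Delta ((1 - t) *\<^sub>R Log_Delta x + t *\<^sub>R Log_Delta y)"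

definition LV_mean :: "real^3^3 \<Rightarrow> real^3^3 \<Rightarrow> real^3^3" where
  "LV_mean x y = gamma_Delta x y (1/2)"

end

(* The clan exponential is a diffeomorphism from V onto the cone under which the connection becomes
   flat and the metric becomes the constant inner product Q_Delta.  In logarithmic coordinates geodesics
   of both connections are therefore affine segments, and the distance is the Euclidean one.

   Explicit formulas for Exp and Log involve only exp, ln and the entire function (exp u - 1) / u.
   The principal logarithm is characterised among all real 3x3 matrices: if exp X = T has positive
   eigenvalues and the spectrum of X lies in the strip, then X has real spectrum, and such a matrix is
   determined by its exponential, because exp (s X) - exp (s Y) has entries that are exponential
   polynomials with real exponents and infinitely many zeros. *)

theory Submission
  imports Defs "HOL-Computational_Algebra.Fundamental_Theorem_Algebra"
begin

subsection \<open>The matrix exponential and the principal logarithm\<close>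

text \<open>The cone has empty interior in the space of all matrices. A derivative within it is
  unique only along directions in \<open>V\<close>, and \<open>frechet_derivative\<close>, being a
  choice, is undetermined elsewhere. The chosen derivatives are therefore compared only on
  \<open>V\<close>, and auxiliary derivatives are composed with a linear projection onto
  \<open>V\<close>. The exponential is studied as the solution of F' = A F. Splitting an
  annihilating polynomial of A into real linear factors reduces this to scalar equations g' = l g +
  h, where g exp(-l s) is differentiated. This one device yields uniqueness of solutions, hence
  exp((s + t) A) = exp(s A) exp(t A), and also the propagation of unbounded zero sets by Rolle. Real
  roots are essential: sin has infinitely many zeros too, and the generator of the rotation by 2 pi
  has the same exponential as 0. The addition formula supplies the zeros: exp X = exp Y gives exp(k
  X) = exp(k Y) for every natural k.\<close>

lemma mat_power_0 [simp]: "mat_power A 0 = mat 1"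
  by (simp add: mat_power_def)

lemma mat_power_Suc [simp]: "mat_power A (Suc n) = A ** mat_power A n"
  by (simp add: mat_power_def)

lemma mat_power_scaleR: "mat_power (s *\<^sub>R A) n = s ^ n *\<^sub>R mat_power A n"
  by (induction n) (simp_all add: scalar_matrix_assoc[symmetric] matrix_scalar_ac scalar_mult_eq_scaleR[symmetric] mult.commute)

text \<open>The 3 counts the summands in one entry of a matrix product. A geometric bound is what
  comparison with the exponential series asks for.\<close>

lemma abs_mat_power_entry_le: "\<bar>mat_power A n $ i $ j\<bar> \<le> (3 * norm A) ^ n"
proof (induction n arbitrary: i j)
  case (Suc n)
  have e: "\<bar>A $ i $ k\<bar> \<le> norm A" for k
    using component_le_norm_cart[of "A $ i" k] Finite_Cartesian_Product.norm_nth_le[of A i] by linarith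
  have "\<bar>mat_power A (Suc n) $ i $ j\<bar> \<le> (\<Sum>k\<in>UNIV. \<bar>A $ i $ k * mat_power A n $ k $ j\<bar>)"
    by (simp add: matrix_matrix_mult_def)
  also have "\<dots> \<le> (\<Sum>k\<in>(UNIV::3 set). norm A * (3 * norm A) ^ n)"
    using e Suc by (intro sum_mono) (simp only: abs_mult mult_mono abs_ge_zero norm_ge_zero)
  also have "\<dots> = (3 * norm A) ^ Suc n"
    by simp
  finally show ?case .
qed (simp add: mat_def)

text \<open>The variable \<open>s\<close> makes each entry of exp(s A) an everywhere convergent
  power series, which may be differentiated termwise.\<close>

lemma summable_mat_power_entry:
  "summable (\<lambda>n. mat_power A n $ i $ j / fact n * s ^ n)"
proof (rule summable_comparison_test)
  show "summable (\<lambda>n. inverse (fact n) * (3 * norm A * \<bar>s\<bar>) ^ n)"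
    by (rule summable_exp)
  show "\<exists>N. \<forall>n\<ge>N. norm (mat_power A n $ i $ j / fact n * s ^ n)
      \<le> inverse (fact n) * (3 * norm A * \<bar>s\<bar>) ^ n"
  proof (intro exI allI impI)
    fix n
    have "\<bar>mat_power A n $ i $ j\<bar> * \<bar>s\<bar> ^ n \<le> (3 * norm A) ^ n * \<bar>s\<bar> ^ n"
      by (intro mult_right_mono abs_mat_power_entry_le) simp
    then show "norm (mat_power A n $ i $ j / fact n * s ^ n)
        \<le> inverse (fact n) * (3 * norm A * \<bar>s\<bar>) ^ n"
      by (simp add: abs_mult power_abs power_mult_distrib divide_simps)
  qed
qed

lemma sums_matI:
  fixes f :: "nat \<Rightarrow> real^'n^'m"
  assumes "\<And>i j. (\<lambda>n. f n $ i $ j) sums (s $ i $ j)"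
  shows "f sums s"
  using assms unfolding sums_def
  by (intro vec_tendstoI) (simp add: sum_component)

lemma mat_exp_entry: "mat_exp A $ i $ j = (\<Sum>n. mat_power A n $ i $ j / fact n)"
proof -
  have "(\<lambda>n. (1 / fact n) *\<^sub>R mat_power A n) sums (\<chi> i j. \<Sum>n. mat_power A n $ i $ j / fact n)"
    using summable_mat_power_entry[of A _ _ 1]
    by (intro sums_matI) (simp add: summable_sums)
  then show ?thesis
    by (simp add: mat_exp_def sums_iff)
qed

lemma mat_exp_entry_sums: "(\<lambda>n. mat_power A n $ i $ j / fact n) sums (mat_exp A $ i $ j)"
  using summable_mat_power_entry[of A i j 1] by (simp add: mat_exp_entry summable_sums)

lemma mat_expI:
  assumes "\<And>i j. (\<lambda>n. mat_power A n $ i $ j / fact n) sums (B $ i $ j)"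
  shows "mat_exp A = B"
  using assms by (simp add: vec_eq_iff mat_exp_entry sums_iff)

lemma mat_exp_0 [simp]: "mat_exp 0 = mat 1"
proof (rule mat_expI)
  fix i j :: 3
  have "mat_power 0 n $ i $ j / fact n = (if n = 0 then mat 1 $ i $ j else 0)" for n
    by (cases n) simp_all
  then show "(\<lambda>n. mat_power 0 n $ i $ j / fact n) sums (mat 1 $ i $ j)"
    using sums_single[of 0 "\<lambda>_. mat 1 $ i $ j :: real"] by simp
qed

lemma DERIV_mat_exp_scaleR_entry:
  "((\<lambda>s. mat_exp (s *\<^sub>R A) $ i $ j) has_real_derivative (A ** mat_exp (s *\<^sub>R A)) $ i $ j) (at s)"
proof -
  let ?c = "\<lambda>i n. mat_power A n $ i $ j / fact n"
  have e: "mat_exp (s *\<^sub>R A) $ i $ j = (\<Sum>n. ?c i n * s ^ n)" for s i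
    by (simp add: mat_exp_entry mat_power_scaleR mult.commute)
  \<comment> \<open>\<open>diffs\<close> turns the factorial of n + 1 into that of n and raises the
    matrix power by one; the additional factor A is the one in F' = A F.\<close>
  have d: "diffs (?c i) n * s ^ n = (\<Sum>k\<in>UNIV. A $ i $ k * (?c k n * s ^ n))" for n
  proof -
    have "diffs (?c i) n = (A ** mat_power A n) $ i $ j / fact n"
      by (simp add: diffs_def del: of_nat_Suc)
    then show ?thesis
      by (simp add: matrix_matrix_mult_def sum_distrib_right sum_divide_distrib mult.assoc)
  qed
  have "((\<lambda>s. \<Sum>n. ?c i n * s ^ n) has_real_derivative (\<Sum>n. diffs (?c i) n * s ^ n)) (at s)"
    by (intro termdiffs_strong_converges_everywhere summable_mat_power_entry)
  also have "(\<Sum>n. diffs (?c i) n * s ^ n) = (\<Sum>k\<in>UNIV. \<Sum>n. A $ i $ k * (?c k n * s ^ n))"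
    unfolding d by (intro suminf_sum summable_mult summable_mat_power_entry)
  also have "\<dots> = (\<Sum>k\<in>UNIV. A $ i $ k * (\<Sum>n. ?c k n * s ^ n))"
    by (intro sum.cong refl suminf_mult summable_mat_power_entry)
  also have "\<dots> = (A ** mat_exp (s *\<^sub>R A)) $ i $ j"
    by (simp add: matrix_matrix_mult_def e)
  finally show ?thesis
    by (simp add: e)
qed

section \<open>Linear flows F' = A F and annihilating polynomials with real roots\<close>

definition mat_flow :: "real^3^3 \<Rightarrow> (real \<Rightarrow> real^3^3) \<Rightarrow> bool" where
  "mat_flow A F \<longleftrightarrow>
     (\<forall>i j s. ((\<lambda>s. F s $ i $ j) has_real_derivative (A ** F s) $ i $ j) (at s))"

lemma mat_flow_mat_exp: "mat_flow A (\<lambda>s. mat_exp (s *\<^sub>R A))"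
  by (simp add: mat_flow_def DERIV_mat_exp_scaleR_entry)

lemma mat_flow_shift: "mat_flow A F \<Longrightarrow> mat_flow A (\<lambda>s. F (s + t))"
  unfolding mat_flow_def by (intro allI DERIV_shift[THEN iffD1]) simp

lemma mat_flow_mult_right:
  assumes "mat_flow A F"
  shows "mat_flow A (\<lambda>s. F s ** B)"
  unfolding mat_flow_def
proof (intro allI)
  fix i j s
  have "((\<lambda>s. \<Sum>k\<in>UNIV. F s $ i $ k * B $ k $ j) has_real_derivative
      (\<Sum>k\<in>UNIV. (A ** F s) $ i $ k * B $ k $ j)) (at s)"
    using assms by (intro DERIV_sum DERIV_cmult_right) (auto simp: mat_flow_def)
  then show "((\<lambda>s. (F s ** B) $ i $ j) has_real_derivative (A ** (F s ** B)) $ i $ j) (at s)"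
    by (simp add: matrix_mul_assoc) (simp add: matrix_matrix_mult_def)
qed

lemma mat_flow_diff:
  assumes "mat_flow A F" "mat_flow A G"
  shows "mat_flow A (\<lambda>s. F s - G s)"
  using assms unfolding mat_flow_def
  by (auto simp: matrix_matrix_mult_def sum_subtractf right_diff_distrib
      intro!: DERIV_diff)

lemma mat_flow_entry_mult_left:
  assumes "mat_flow A F"
  shows "((\<lambda>s. (P ** F s) $ i $ j) has_real_derivative (P ** A ** F s) $ i $ j) (at s)"
proof -
  have "((\<lambda>s. \<Sum>k\<in>UNIV. P $ i $ k * F s $ k $ j) has_real_derivative
      (\<Sum>k\<in>UNIV. P $ i $ k * (A ** F s) $ k $ j)) (at s)"
    using assms by (intro DERIV_sum DERIV_cmult) (auto simp: mat_flow_def)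
  then show ?thesis
    by (simp add: matrix_mul_assoc[symmetric]) (simp add: matrix_matrix_mult_def)
qed

text \<open>A solution of \<open>(D - l\<^sub>0) \<dots> (D - l\<^sub>n\<^sub>-\<^sub>1) g = 0\<close>, with its intermediate factors, where each
  factor vanishes somewhere.\<close>

lemma exp_chain_zero:
  fixes g :: "nat \<Rightarrow> real \<Rightarrow> real"
  assumes der: "\<And>k s. k < n \<Longrightarrow> (g k has_real_derivative l k * g k s + g (Suc k) s) (at s)"
    and last: "\<And>s. g n s = 0"
    and zero: "\<And>k. k < n \<Longrightarrow> \<exists>s. g k s = 0"
  shows "g 0 s = 0"
proof -
  have "\<forall>s. g k s = 0" if "k \<le> n" for k
    using that
  proof (induction k rule: inc_induct)
    case base
    then show ?case using last by simp
  next
    case (step k)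
    have "((\<lambda>s. exp (- l k * s) * g k s) has_real_derivative 0) (at s)" for s
      using step by (auto intro!: derivative_eq_intros der simp: algebra_simps)
    then have c: "exp (- l k * s) * g k s = exp (- l k * t) * g k t" for s t
      using DERIV_isconst_all[of "\<lambda>s. exp (- l k * s) * g k s" s t] by blast
    obtain t where "g k t = 0"
      using zero step by blast
    then show ?case
      using c[of _ t] by simp
  qed
  then show ?thesis by simp
qed

text \<open>The function g exp(-l s) has derivative h exp(-l s), so Rolle puts a zero of h between
  any two zeros of g. Taking both beyond N keeps the zeros unbounded.\<close>

lemma Rolle_unbounded_zeros:
  fixes g h :: "real \<Rightarrow> real"
  assumes der: "\<And>s. (g has_real_derivative l * g s + h s) (at s)"
    and zero: "\<And>N. \<exists>s>N. g s = 0"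
  shows "\<exists>s>N. h s = 0"
proof -
  obtain a where a: "a > N" "g a = 0" using zero by blast
  obtain b where b: "b > a" "g b = 0" using zero by blast
  have d: "((\<lambda>s. exp (- l * s) * g s) has_real_derivative exp (- l * s) * h s) (at s)" for s
    by (auto intro!: derivative_eq_intros der simp: algebra_simps)
  have "\<exists>z>a. z < b \<and> exp (- l * z) * h z = 0"
  proof -
    have "continuous_on {a..b} (\<lambda>s. exp (- l * s) * g s)"
      using d by (meson DERIV_isCont continuous_at_imp_continuous_on)
    then obtain z where "a < z" "z < b" "(\<lambda>x. exp (- l * z) * h z * x) = (\<lambda>x. 0)"
      using Rolle_deriv[of a b "\<lambda>s. exp (- l * s) * g s" "\<lambda>s x. exp (- l * s) * h s * x"] a b d
      by (auto simp: has_field_derivative_def)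
    then show ?thesis
      by (metis mult.right_neutral)
  qed
  then show ?thesis
    using a by (metis exp_not_eq_zero less_trans mult_eq_0_iff)
qed

text \<open>That (A - l 0) ... (A - l (n - 1)) vanishes for some real \<open>l\<close> is the
  working form of "A has real spectrum". The partial products form the chain of intermediate
  factors.\<close>

definition mat_root_factor :: "real^3^3 \<Rightarrow> (nat \<Rightarrow> real) \<Rightarrow> nat \<Rightarrow> real^3^3" where
  "mat_root_factor A l n = rec_nat (mat 1) (\<lambda>k P. P ** (A - mat (l k))) n"

lemma matrix_add_rdistrib: "(A + B) ** C = A ** C + B ** (C :: 'a::semiring_1^'n^'m)"
  by (vector matrix_matrix_mult_def sum.distrib distrib_right)

lemma matrix_diff_ldistrib: "A ** (B - C) = A ** B - A ** (C :: 'a::ring_1^'n^'m)"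
  by (vector matrix_matrix_mult_def sum_subtractf right_diff_distrib)

lemma mat_root_factor_simps [simp]:
  "mat_root_factor A l 0 = mat 1"
  "mat_root_factor A l (Suc n) = mat_root_factor A l n ** (A - mat (l n))"
  by (simp_all add: mat_root_factor_def)

lemma matrix_mult_mat: "P ** mat c = c *\<^sub>R (P :: real^'n^'m)"
  by (simp add: vec_eq_iff matrix_matrix_mult_def mat_def if_distrib mult.commute cong: if_cong)

text \<open>Since P_k A = l_k P_k + P_(k+1), the entries of P_k F form a chain as in
  \<open>exp_chain_zero\<close>.\<close>

lemma mat_flow_root_factor:
  assumes "mat_flow A F"
  shows "((\<lambda>s. (mat_root_factor A l k ** F s) $ i $ j) has_real_derivative
     l k * (mat_root_factor A l k ** F s) $ i $ j + (mat_root_factor A l (Suc k) ** F s) $ i $ j) (at s)"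
proof -
  let ?P = "mat_root_factor A l k"
  have "?P ** A = l k *\<^sub>R ?P + mat_root_factor A l (Suc k)"
    by (simp add: matrix_diff_ldistrib matrix_mult_mat)
  then have "?P ** A ** F s = l k *\<^sub>R (?P ** F s) + mat_root_factor A l (Suc k) ** F s"
    by (simp add: matrix_add_rdistrib scalar_matrix_assoc[unfolded scalar_mult_eq_scaleR])
  then show ?thesis
    using mat_flow_entry_mult_left[OF assms, of ?P i j s] by simp
qed

text \<open>With F 0 = 0 every member of the chain vanishes at 0, and the last one vanishes
  identically, so the chain collapses down to F itself.\<close>

lemma mat_flow_eq_0:
  assumes F: "mat_flow A F" and z: "F 0 = 0" and n: "mat_root_factor A l n = 0"
  shows "F s = 0"
proof -
  have "(mat_root_factor A l 0 ** F s) $ i $ j = 0" for i j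
    using mat_flow_root_factor[OF F] z n
    by (intro exp_chain_zero[of n "\<lambda>k s. (mat_root_factor A l k ** F s) $ i $ j" l])
       (auto intro!: exI[of _ 0])
  then show ?thesis
    by (simp add: vec_eq_iff)
qed


text \<open>As functions of \<open>s\<close>, both sides solve F' = A F and agree at s = 0; the
  hypothesis gives access to \<open>mat_flow_eq_0\<close>.\<close>

lemma mat_exp_add:
  assumes "mat_root_factor A l n = 0"
  shows "mat_exp ((s + t) *\<^sub>R A) = mat_exp (s *\<^sub>R A) ** mat_exp (t *\<^sub>R A)"
proof -
  have "mat_flow A (\<lambda>s. mat_exp ((s + t) *\<^sub>R A) - mat_exp (s *\<^sub>R A) ** mat_exp (t *\<^sub>R A))"
    by (intro mat_flow_diff mat_flow_shift mat_flow_mult_right mat_flow_mat_exp)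
  from mat_flow_eq_0[OF this _ assms, of s] show ?thesis
    by simp
qed

lemma mat_root_factor_cong:
  "(\<And>k. k < n \<Longrightarrow> l k = l' k) \<Longrightarrow> mat_root_factor A l n = mat_root_factor A l' n"
  by (induction n) simp_all

lemma mat_root_factor_append:
  "mat_root_factor A (\<lambda>k. if k < n then l k else l' (k - n)) (n + m)
     = mat_root_factor A l n ** mat_root_factor A l' m"
proof (induction m)
  case 0
  show ?case by (auto intro: mat_root_factor_cong)
qed (simp add: matrix_mul_assoc)

lemma mat_exp_inject:
  assumes X: "mat_root_factor X l n = 0" and Y: "mat_root_factor Y l' m = 0"
    and eq: "mat_exp X = mat_exp Y"
  shows "X = Y"
proof -
  \<comment> \<open>Concatenating the two root lists gives one sequence of scalar operators that
    annihilates the entries of both exponentials.\<close>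
  define L where "L = (\<lambda>k. if k < n then l k else l' (k - n))"
  have LX: "mat_root_factor X L (n + m) = 0" and LY: "mat_root_factor Y L (n + m) = 0"
    by (simp_all add: L_def mat_root_factor_append X Y)
  have nat: "mat_exp (real k *\<^sub>R X) = mat_exp (real k *\<^sub>R Y)" for k
  proof (induction k)
    case (Suc k)
    have "mat_exp ((real k + 1) *\<^sub>R X) = mat_exp ((real k + 1) *\<^sub>R Y)"
      using Suc eq by (simp add: mat_exp_add[OF X] mat_exp_add[OF Y] del: scaleR_left_distrib)
    then show ?case by (simp add: add.commute)
  qed simp
  have ent: "mat_exp (s *\<^sub>R X) $ i $ j = mat_exp (s *\<^sub>R Y) $ i $ j" for s i j
  proof -
    define g where "g k s = (mat_root_factor X L k ** mat_exp (s *\<^sub>R X)) $ i $ j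
        - (mat_root_factor Y L k ** mat_exp (s *\<^sub>R Y)) $ i $ j" for k s
    have der: "(g k has_real_derivative L k * g k s + g (Suc k) s) (at s)" for k s
      using DERIV_diff[OF mat_flow_root_factor[OF mat_flow_mat_exp] mat_flow_root_factor[OF mat_flow_mat_exp]]
      unfolding g_def by (rule DERIV_cong) (simp add: algebra_simps)
    \<comment> \<open>All natural numbers are zeros of \<open>g 0\<close>; each Rolle step passes
      unboundedness of the zero set from \<open>g k\<close> to \<open>g (Suc k)\<close>.\<close>
    have zero: "\<exists>s>N. g k s = 0" for k N
    proof (induction k arbitrary: N)
      case 0
      obtain p :: nat where "real p > N"
        using reals_Archimedean2 by blast
      then show ?case
        by (intro exI[of _ "real p"]) (simp add: g_def nat)
    next
      case (Suc k)
      then show ?case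
        using Rolle_unbounded_zeros[OF der] by blast
    qed
    have "g 0 s = 0"
    proof (rule exp_chain_zero[of "n + m" g L])
      show "(g k has_real_derivative L k * g k s + g (Suc k) s) (at s)" for k s
        by (rule der)
      show "g (n + m) s = 0" for s
        by (simp add: g_def LX LY)
      show "\<exists>s. g k s = 0" for k
        using zero by blast
    qed
    then show ?thesis
      by (simp add: g_def)
  qed
  \<comment> \<open>The curves exp(s X) and exp(s Y) now agree for every s; their derivatives at s =
    0 are X and Y.\<close>
  have "X $ i $ j = Y $ i $ j" for i j
    using DERIV_unique DERIV_mat_exp_scaleR_entry[of X i j 0] DERIV_mat_exp_scaleR_entry[of Y i j 0]
    by (simp add: ent)
  then show ?thesis
    by (simp add: vec_eq_iff)
qed

section \<open>Complex spectrum and the principal logarithm\<close>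

lemma det_eq_0_iff_kernel:
  fixes A :: "'a::field^'n^'n"
  shows "det A = 0 \<longleftrightarrow> (\<exists>v. v \<noteq> 0 \<and> A *v v = 0)"
  using invertible_det_nz[of A] matrix_left_invertible_ker[of A]
  by (auto simp: invertible_left_inverse)

lemma complex_eigenvalue_iff:
  "complex_eigenvalue A z \<longleftrightarrow>
     (\<exists>v. v \<noteq> 0 \<and> (\<forall>i. (\<Sum>j\<in>UNIV. of_real (A $ i $ j) * v $ j) = z * v $ i))"
proof -
  have "(mat z - map_matrix complex_of_real A) *v v = 0 \<longleftrightarrow>
      (\<forall>i. (\<Sum>j\<in>UNIV. of_real (A $ i $ j) * v $ j) = z * v $ i)" for v
  proof -
    have "((mat z - map_matrix complex_of_real A) *v v) $ i
        = z * v $ i - (\<Sum>j\<in>UNIV. of_real (A $ i $ j) * v $ j)" for i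
      by (simp add: matrix_vector_mult_def mat_def map_matrix_def left_diff_distrib sum_subtractf
          if_distrib[of "\<lambda>x. x * _"] cong: if_cong)
    then show ?thesis
      by (auto simp: vec_eq_iff)
  qed
  then show ?thesis
    by (simp add: complex_eigenvalue_def det_eq_0_iff_kernel)
qed

text \<open>An eigenvector of A for z is one of the n-th power for z ^ n; summing the series gives
  exp z with the same vector.\<close>

lemma complex_eigenvalue_mat_exp:
  assumes "complex_eigenvalue A z"
  shows "complex_eigenvalue (mat_exp A) (exp z)"
proof -
  obtain v where v: "v \<noteq> 0" "\<And>i. (\<Sum>j\<in>UNIV. of_real (A $ i $ j) * v $ j) = z * v $ i"
    using assms by (auto simp: complex_eigenvalue_iff)
  have pow: "(\<Sum>j\<in>UNIV. of_real (mat_power A n $ i $ j) * v $ j) = z ^ n * v $ i" for n i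
  proof (induction n arbitrary: i)
    case 0
    show ?case
      by (simp add: mat_def if_distrib[of complex_of_real] if_distrib[of "\<lambda>x. x * _"] cong: if_cong)
  next
    case (Suc n)
    have "(\<Sum>j\<in>UNIV. of_real (mat_power A (Suc n) $ i $ j) * v $ j)
        = (\<Sum>j\<in>UNIV. \<Sum>k\<in>UNIV. of_real (A $ i $ k) * (of_real (mat_power A n $ k $ j) * v $ j))"
      by (simp add: matrix_matrix_mult_def sum_distrib_right mult.assoc)
    also have "\<dots> = (\<Sum>k\<in>UNIV. of_real (A $ i $ k) * (z ^ n * v $ k))"
      by (subst sum.swap) (simp add: sum_distrib_left[symmetric] Suc)
    also have "\<dots> = z ^ n * (\<Sum>k\<in>UNIV. of_real (A $ i $ k) * v $ k)"
      by (simp add: sum_distrib_left mult_ac)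
    finally show ?case
      by (simp add: v)
  qed
  have "(\<Sum>j\<in>UNIV. of_real (mat_exp A $ i $ j) * v $ j) = exp z * v $ i" for i
  proof -
    have "(\<lambda>n. \<Sum>j\<in>UNIV. of_real (mat_power A n $ i $ j / fact n) * v $ j)
        sums (\<Sum>j\<in>UNIV. of_real (mat_exp A $ i $ j) * v $ j)"
      by (intro sums_sum sums_mult2 sums_of_real mat_exp_entry_sums)
    moreover have "(\<Sum>j\<in>UNIV. of_real (mat_power A n $ i $ j / fact n) * v $ j)
        = (z ^ n /\<^sub>R fact n) * v $ i" for n
    proof -
      have "(\<Sum>j\<in>UNIV. of_real (mat_power A n $ i $ j / fact n) * v $ j)
          = (\<Sum>j\<in>UNIV. of_real (mat_power A n $ i $ j) * v $ j) / fact n"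
        by (simp add: sum_divide_distrib)
      then show ?thesis
        unfolding pow by (simp add: scaleR_conv_of_real divide_simps)
    qed
    moreover have "(\<lambda>n. (z ^ n /\<^sub>R fact n) * v $ i) sums (exp z * v $ i)"
      by (intro sums_mult2 exp_converges)
    ultimately show ?thesis
      by (simp add: sums_iff)
  qed
  with v(1) show ?thesis
    by (auto simp: complex_eigenvalue_iff)
qed

text \<open>Cayley-Hamilton: the hypotheses equate the trace, the sum of the principal 2x2 minors
  and the determinant with the elementary symmetric functions of a, b, c.\<close>

lemma mat_root_factor_3_eq_0:
  assumes "A$1$1 + A$2$2 + A$3$3 = a + b + c"
    and "A$1$1 * A$2$2 - A$1$2 * A$2$1 + (A$1$1 * A$3$3 - A$1$3 * A$3$1)
       + (A$2$2 * A$3$3 - A$2$3 * A$3$2) = a * b + a * c + b * c"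
    and "det A = a * b * c"
  shows "mat_root_factor A (\<lambda>k. [a, b, c] ! k) 3 = 0"
proof -
  have "(A - mat a) ** (A - mat b) ** (A - mat c)
      = A ** A ** A - (a + b + c) *\<^sub>R (A ** A) + (a * b + a * c + b * c) *\<^sub>R A - mat (a * b * c)"
    by (simp add: vec_eq_iff forall_3 matrix_matrix_mult_def mat_def sum_3 algebra_simps)
  also have "\<dots> = 0"
    unfolding assms[symmetric]
    by (simp add: vec_eq_iff forall_3 matrix_matrix_mult_def mat_def sum_3 det_3 algebra_simps)
  finally show ?thesis
    by (simp add: numeral_3_eq_3)
qed

lemma mat_root_factor_real_spectrum:
  assumes real: "\<And>z. complex_eigenvalue A z \<Longrightarrow> Im z = 0"
  shows "\<exists>l. mat_root_factor A l 3 = 0"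
proof -
  define t m d where "t = complex_of_real (A$1$1 + A$2$2 + A$3$3)"
    and "m = complex_of_real (A$1$1 * A$2$2 - A$1$2 * A$2$1 + (A$1$1 * A$3$3 - A$1$3 * A$3$1)
       + (A$2$2 * A$3$3 - A$2$3 * A$3$2))"
    and "d = complex_of_real (det A)"
  have char: "complex_eigenvalue A z \<longleftrightarrow> z^3 - t * z^2 + m * z - d = 0" for z
  proof -
    have "det (mat z - map_matrix complex_of_real A) = z^3 - t * z^2 + m * z - d"
      by (simp add: det_3 t_def m_def d_def mat_def map_matrix_def power2_eq_square power3_eq_cube
          algebra_simps)
    then show ?thesis
      by (simp add: complex_eigenvalue_def)
  qed
  have "\<exists>z. poly [:-d, m, -t, 1:] z = 0"
    by (rule fundamental_theorem_of_algebra_alt) auto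
  then obtain z1 where "poly [:-d, m, -t, 1:] z1 = 0" ..
  then have z1: "d = z1^3 - t * z1^2 + m * z1"
    by (simp add: algebra_simps power2_eq_square power3_eq_cube eq_neg_iff_add_eq_0)
  \<comment> \<open>This quadratic is the quotient of the characteristic polynomial by z -
    z1.\<close>
  have "\<exists>z. poly [:m + z1^2 - t * z1, z1 - t, 1:] z = 0"
    by (rule fundamental_theorem_of_algebra_alt) auto
  then obtain z2 where "poly [:m + z1^2 - t * z1, z1 - t, 1:] z2 = 0" ..
  then have z2: "m = t * z1 - z1^2 - z1 * z2 + t * z2 - z2^2"
    by simp algebra
  \<comment> \<open>The trace is the sum of the eigenvalues, which fixes the third one.\<close>
  define z3 where "z3 = t - z1 - z2"
  have fac: "z^3 - t * z^2 + m * z - d = (z - z1) * (z - z2) * (z - z3)" for z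
    unfolding z1 z2 z3_def by (simp add: algebra_simps power2_eq_square power3_eq_cube)
  have "complex_eigenvalue A z1" "complex_eigenvalue A z2" "complex_eigenvalue A z3"
    by (simp_all add: char fac)
  then have "Im z1 = 0" "Im z2 = 0" "Im z3 = 0"
    using real by blast+
  then obtain a b c where abc: "z1 = of_real a" "z2 = of_real b" "z3 = of_real c"
    by (metis complex_is_Real_iff of_real_Re)
  have t: "t = z1 + z2 + z3" and m: "m = z1 * z2 + z1 * z3 + z2 * z3" and d: "d = z1 * z2 * z3"
    unfolding z1 z2 z3_def by (simp_all add: algebra_simps power2_eq_square power3_eq_cube)
  show ?thesis
    by (rule exI, rule mat_root_factor_3_eq_0[of A a b c])
      (use t m d in \<open>simp_all only: abc t_def m_def d_def of_real_add[symmetric] of_real_mult[symmetric] of_real_eq_iff\<close>)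
qed

text \<open>\<open>Ln\<close> inverts exp on the strip and is real on positive reals.\<close>

lemma exp_real_imp_real:
  assumes "exp z = complex_of_real r" "r > 0" "\<bar>Im z\<bar> < pi"
  shows "Im z = 0"
proof -
  have "Ln (exp z) = z"
    using assms by (intro Ln_exp) auto
  then show ?thesis
    using assms by (metis Im_Ln_of_real Ln_of_real Im_complex_of_real)
qed

lemma mat_log_mat_exp:
  assumes spec: "\<And>z. complex_eigenvalue X z \<Longrightarrow> Im z = 0"
    and pos: "\<And>z. complex_eigenvalue (mat_exp X) z \<Longrightarrow> \<exists>r>0. z = complex_of_real r"
  shows "mat_log (mat_exp X) = X"
  unfolding mat_log_def
proof (rule the_equality)
  show "mat_exp X = mat_exp X \<and> (\<forall>z. complex_eigenvalue X z \<longrightarrow> \<bar>Im z\<bar> < pi)"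
    using spec by simp
  fix Y assume Y: "mat_exp Y = mat_exp X \<and> (\<forall>z. complex_eigenvalue Y z \<longrightarrow> \<bar>Im z\<bar> < pi)"
  have "Im z = 0" if "complex_eigenvalue Y z" for z
    using complex_eigenvalue_mat_exp[OF that] pos Y that exp_real_imp_real by metis
  then obtain l where "mat_root_factor Y l 3 = 0"
    using mat_root_factor_real_spectrum by blast
  moreover obtain l' where "mat_root_factor X l' 3 = 0"
    using mat_root_factor_real_spectrum spec by blast
  ultimately show "Y = X"
    using Y mat_exp_inject by blast
qed

subsection \<open>Coordinates on triangular and symmetric matrices\<close>

text \<open>The diagonal comes first among the arguments, then the entries (3,1) and (3,2). The
  entry (2,1) stays 0 under products, so exponentials of lower halves of elements of
  \<open>V\<close> again have this form.\<close>

definition low_mat :: "real \<Rightarrow> real \<Rightarrow> real \<Rightarrow> real \<Rightarrow> real \<Rightarrow> real^3^3" where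
  "low_mat a b e c d = vector [vector [a, 0, 0], vector [0, b, 0], vector [c, d, e]]"

definition sym_mat :: "real \<Rightarrow> real \<Rightarrow> real \<Rightarrow> real \<Rightarrow> real \<Rightarrow> real^3^3" where
  "sym_mat a b e c d = vector [vector [a, 0, c], vector [0, b, d], vector [c, d, e]]"

lemma low_mat_nth [simp]:
  "low_mat a b e c d $ 1 $ 1 = a" "low_mat a b e c d $ 1 $ 2 = 0" "low_mat a b e c d $ 1 $ 3 = 0"
  "low_mat a b e c d $ 2 $ 1 = 0" "low_mat a b e c d $ 2 $ 2 = b" "low_mat a b e c d $ 2 $ 3 = 0"
  "low_mat a b e c d $ 3 $ 1 = c" "low_mat a b e c d $ 3 $ 2 = d" "low_mat a b e c d $ 3 $ 3 = e"
  by (simp_all add: low_mat_def)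

lemma sym_mat_nth [simp]:
  "sym_mat a b e c d $ 1 $ 1 = a" "sym_mat a b e c d $ 1 $ 2 = 0" "sym_mat a b e c d $ 1 $ 3 = c"
  "sym_mat a b e c d $ 2 $ 1 = 0" "sym_mat a b e c d $ 2 $ 2 = b" "sym_mat a b e c d $ 2 $ 3 = d"
  "sym_mat a b e c d $ 3 $ 1 = c" "sym_mat a b e c d $ 3 $ 2 = d" "sym_mat a b e c d $ 3 $ 3 = e"
  by (simp_all add: sym_mat_def)

lemmas mat3_eq_iff = vec_eq_iff forall_3

lemma sym_mat_eq_iff [simp]:
  "sym_mat a b e c d = sym_mat a' b' e' c' d' \<longleftrightarrow> a = a' \<and> b = b' \<and> e = e' \<and> c = c' \<and> d = d'"
  by (auto simp: mat3_eq_iff)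

lemma V_iff: "A \<in> V \<longleftrightarrow> A = sym_mat (A$1$1) (A$2$2) (A$3$3) (A$3$1) (A$3$2)"
  by (auto simp: V_def mat3_eq_iff transpose_def)

lemma sym_mat_in_V [simp]: "sym_mat a b e c d \<in> V"
  by (simp add: V_iff)

lemma V_cases:
  assumes "v \<in> V"
  obtains a b e c d where "v = sym_mat a b e c d"
  using assms V_iff by blast

lemma sym_mat_add: "sym_mat a b e c d + sym_mat a' b' e' c' d'
    = sym_mat (a + a') (b + b') (e + e') (c + c') (d + d')"
  and sym_mat_scaleR: "r *\<^sub>R sym_mat a b e c d = sym_mat (r * a) (r * b) (r * e) (r * c) (r * d)"
  by (simp_all add: mat3_eq_iff)

lemma subspace_V: "subspace V"
  unfolding span_V_basis[symmetric] by (rule subspace_span)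

lemma lower_half_sym_mat: "lower_half (sym_mat a b e c d) = low_mat (a / 2) (b / 2) (e / 2) c d"
  unfolding lower_half_def
  by (rule the_equality) (auto simp: lower_triangular_def mat3_eq_iff transpose_def)

subsection \<open>The exponential of a lower triangular matrix\<close>

text \<open>\<open>psi (u - v) * exp v\<close> is the divided difference of \<open>exp\<close> at \<open>u\<close>, \<open>v\<close>.\<close>

definition psi :: "real \<Rightarrow> real" where
  "psi u = (if u = 0 then 1 else (exp u - 1) / u)"

lemma psi_pos: "psi u > 0"
  by (auto simp: psi_def zero_less_divide_iff)

lemma psi_nonzero [simp]: "psi u \<noteq> 0"
  using psi_pos[of u] by simp

text \<open>The sum of a^i e^j over i + j = n - 1 (empty for n = 0), that is, the divided difference
  of x^n at a and e. The recursion is that of the bottom row when a triangular matrix multiplies its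
  own power.\<close>

fun div_pow :: "real \<Rightarrow> real \<Rightarrow> nat \<Rightarrow> real" where
  "div_pow a e 0 = 0"
| "div_pow a e (Suc n) = a ^ n + e * div_pow a e n"

text \<open>Divided differences pass termwise from the powers to the exponential series; for a = e
  they become derivatives.\<close>

lemma div_pow_sums: "(\<lambda>n. div_pow a e n / fact n) sums (exp a * psi (e - a))"
proof (cases "a = e")
  case True
  have d: "div_pow a a n / fact n = (if n = 0 then 0 else inverse (fact (n - 1)) * a ^ (n - 1))" for n
  proof -
    have "div_pow a a n = n * a ^ (n - 1)"
      by (induction n) (auto simp: algebra_simps power_eq_if)
    then show ?thesis
      by (cases n) (auto simp: field_simps simp del: of_nat_Suc)
  qed
  have "(\<lambda>n. inverse (fact n) * a ^ n) sums exp a"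
    using exp_converges[of a] by simp
  then have "(\<lambda>n. div_pow a a (Suc n) / fact (Suc n)) sums exp a"
    unfolding d by simp
  then have "(\<lambda>n. div_pow a a n / fact n) sums exp a"
    by (rule sums_Suc_imp[rotated]) simp
  then show ?thesis
    using True by (simp add: psi_def)
next
  case False
  have d: "div_pow a e n = (a ^ n - e ^ n) / (a - e)" for n
  proof -
    have "(a - e) * div_pow a e n = a ^ n - e ^ n"
    proof (induction n)
      case (Suc n)
      have "(a - e) * div_pow a e (Suc n) = (a - e) * a ^ n + e * ((a - e) * div_pow a e n)"
        by (simp add: algebra_simps)
      then show ?case
        unfolding Suc by (simp add: algebra_simps)
    qed simp
    then show ?thesis
      using False by (simp add: field_simps)
  qed
  have "(\<lambda>n. (inverse (fact n) * a ^ n - inverse (fact n) * e ^ n) / (a - e)) sums ((exp a - exp e) / (a - e))"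
    using exp_converges[of a] exp_converges[of e] by (intro sums_divide sums_diff) simp_all
  also have "(\<lambda>n. (inverse (fact n) * a ^ n - inverse (fact n) * e ^ n) / (a - e)) = (\<lambda>n. div_pow a e n / fact n)"
    by (simp add: d divide_inverse algebra_simps)
  also have "(exp a - exp e) / (a - e) = exp a * psi (e - a)"
    using False by (simp add: psi_def exp_diff field_simps)
  finally show ?thesis .
qed

lemma mat_power_low_mat: "mat_power (low_mat a b e c d) n
    = low_mat (a ^ n) (b ^ n) (e ^ n) (c * div_pow a e n) (d * div_pow b e n)"
  by (induction n) (simp_all add: mat3_eq_iff matrix_matrix_mult_def sum_3 mat_def algebra_simps)

lemma mat_exp_low_mat: "mat_exp (low_mat a b e c d)
    = low_mat (exp a) (exp b) (exp e) (c * (exp a * psi (e - a))) (d * (exp b * psi (e - b)))"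
proof (rule mat_expI)
  have e: "(\<lambda>n. x ^ n / fact n) sums exp x" for x :: real
    using exp_converges[of x] by (simp add: divide_inverse mult.commute)
  have "\<forall>i j. (\<lambda>n. mat_power (low_mat a b e c d) n $ i $ j / fact n) sums
      (low_mat (exp a) (exp b) (exp e) (c * (exp a * psi (e - a))) (d * (exp b * psi (e - b))) $ i $ j)"
    using sums_mult[OF div_pow_sums[of a e], of c] sums_mult[OF div_pow_sums[of b e], of d]
    by (simp add: forall_3 mat_power_low_mat e)
  then show "(\<lambda>n. mat_power (low_mat a b e c d) n $ i $ j / fact n) sums
      (low_mat (exp a) (exp b) (exp e) (c * (exp a * psi (e - a))) (d * (exp b * psi (e - b))) $ i $ j)" for i j
    by blast
qed

lemma complex_eigenvalue_low_mat:
  "complex_eigenvalue (low_mat a b e c d) z \<longleftrightarrow> z = of_real a \<or> z = of_real b \<or> z = of_real e"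
  by (simp add: complex_eigenvalue_def det_3 mat_def map_matrix_def)

text \<open>The spectrum of a triangular matrix is its diagonal: real before exponentiation and
  positive after it.\<close>

lemma mat_log_low_mat: "mat_log (mat_exp (low_mat a b e c d)) = low_mat a b e c d"
proof (rule mat_log_mat_exp)
  show "Im z = 0" if "complex_eigenvalue (low_mat a b e c d) z" for z
    using that by (auto simp: complex_eigenvalue_low_mat)
  show "\<exists>r>0. z = complex_of_real r" if "complex_eigenvalue (mat_exp (low_mat a b e c d)) z" for z
    using that unfolding mat_exp_low_mat complex_eigenvalue_low_mat by (metis exp_gt_zero)
qed

lemma low_mat_mult_transpose: "low_mat p q r s t ** transpose (low_mat p q r s t)
    = sym_mat (p^2) (q^2) (r^2 + s^2 + t^2) (p * s) (q * t)"
  by (simp add: mat3_eq_iff matrix_matrix_mult_def sum_3 transpose_def power2_eq_square)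

lemma cholesky_low_mat:
  assumes "p > 0" "q > 0" "r > 0"
  shows "cholesky (low_mat p q r s t ** transpose (low_mat p q r s t)) = low_mat p q r s t"
  unfolding cholesky_def
proof (rule the_equality)
  show "lower_triangular (low_mat p q r s t) \<and> (\<forall>i. low_mat p q r s t $ i $ i > 0) \<and>
    low_mat p q r s t ** transpose (low_mat p q r s t) = low_mat p q r s t ** transpose (low_mat p q r s t)"
    using assms by (simp add: lower_triangular_def forall_3)
  fix T
  assume T: "lower_triangular T \<and> (\<forall>i. T$i$i > 0) \<and>
    low_mat p q r s t ** transpose (low_mat p q r s t) = T ** transpose T"
  then have z: "T$1$2 = 0" "T$1$3 = 0" "T$2$3 = 0" and pos: "T$1$1 > 0" "T$2$2 > 0" "T$3$3 > 0"
    by (auto simp: lower_triangular_def)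
  have "sym_mat (p^2) (q^2) (r^2 + s^2 + t^2) (p * s) (q * t) = T ** transpose T"
    using T by (simp add: low_mat_mult_transpose)
  then have e: "(T$1$1)^2 = p^2" "T$1$1 * T$2$1 = 0" "T$1$1 * T$3$1 = p * s" "(T$2$1)^2 + (T$2$2)^2 = q^2"
    "T$2$1 * T$3$1 + T$2$2 * T$3$2 = q * t" "(T$3$1)^2 + (T$3$2)^2 + (T$3$3)^2 = r^2 + s^2 + t^2"
    by (simp_all add: mat3_eq_iff matrix_matrix_mult_def sum_3 transpose_def power2_eq_square z)
  have 1: "T$1$1 = p"
    using e(1) pos assms by (simp add: power2_eq_iff_nonneg)
  \<comment> \<open>A competitor \<open>T\<close> may a priori have a nonzero entry (2,1); the
    vanishing (2,1) entry of the product together with \<open>T$1$1 = p\<close> and p > 0 excludes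
    this.\<close>
  then have 2: "T$2$1 = 0" "T$3$1 = s"
    using e(2,3) assms by auto
  then have 3: "T$2$2 = q"
    using e(4) pos assms by (simp add: power2_eq_iff_nonneg)
  then have 4: "T$3$2 = t"
    using e(5) 2 assms by simp
  then have "T$3$3 = r"
    using e(6) 2 pos assms by (simp add: power2_eq_iff_nonneg)
  with 1 2 3 4 z show "T = low_mat p q r s t"
    by (simp add: mat3_eq_iff)
qed

subsection \<open>The cone and its exponential in coordinates\<close>

text \<open>On \<open>V\<close> this is the Schur complement of the diagonal upper left 2x2 block;
  on the cone it is the square of the last diagonal entry of the Cholesky factor.\<close>

definition schur :: "real^3^3 \<Rightarrow> real" where
  "schur A = A$3$3 - (A$3$1)^2 / A$1$1 - (A$3$2)^2 / A$2$2"

lemma Omega_iff: "x \<in> Omega \<longleftrightarrow> x \<in> V \<and> x$1$1 > 0 \<and> x$2$2 > 0 \<and> schur x > 0"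
proof (cases "x \<in> V")
  case True
  then obtain a b e c d where x: "x = sym_mat a b e c d"
    by (rule V_cases)
  have s: "transpose x = x"
    using True by (simp add: V_def)
  have q: "v \<bullet> (x *v v) = a * (v$1)^2 + b * (v$2)^2 + e * (v$3)^2 + 2 * c * v$1 * v$3 + 2 * d * v$2 * v$3" for v
    by (simp add: x inner_vec_def sum_3 matrix_vector_mult_def power2_eq_square algebra_simps)
  have "(\<forall>v. v \<noteq> 0 \<longrightarrow> v \<bullet> (x *v v) > 0) \<longleftrightarrow> a > 0 \<and> b > 0 \<and> e - c^2 / a - d^2 / b > 0"
  proof safe
    assume pd: "\<forall>v. v \<noteq> 0 \<longrightarrow> v \<bullet> (x *v v) > 0"
    have nz: "vector [p, q, r] \<noteq> (0 :: real^3)" if "p \<noteq> 0 \<or> q \<noteq> 0 \<or> r \<noteq> 0" for p q r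
      using that by (simp add: vec_eq_iff forall_3)
    show a: "a > 0"
      using pd[rule_format, OF nz, of 1 0 0] by (simp add: q)
    show b: "b > 0"
      using pd[rule_format, OF nz, of 0 1 0] by (simp add: q)
    \<comment> \<open>The test vector (-c/a, -d/b, 1) annihilates both squares of the completed form
      and leaves the Schur complement.\<close>
    show "e - c^2 / a - d^2 / b > 0"
      using pd[rule_format, OF nz, of "- c / a" "- d / b" 1] a b
      by (simp add: q power_divide power2_eq_square divide_simps) (simp add: algebra_simps)
  next
    fix v :: "real^3"
    assume a: "a > 0" and b: "b > 0" and D: "e - c^2 / a - d^2 / b > 0" and "v \<noteq> 0"
    have "v \<bullet> (x *v v) = a * (v$1 + c / a * v$3)^2 + b * (v$2 + d / b * v$3)^2
        + (e - c^2 / a - d^2 / b) * (v$3)^2"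
      using a b by (simp add: q power2_eq_square field_simps)
    moreover have "v$3 \<noteq> 0 \<or> v$1 + c / a * v$3 \<noteq> 0 \<or> v$2 + d / b * v$3 \<noteq> 0"
      using \<open>v \<noteq> 0\<close> by (auto simp: vec_eq_iff forall_3)
    ultimately show "v \<bullet> (x *v v) > 0"
      using a b D
      by (smt (verit) mult_nonneg_nonneg mult_pos_pos zero_le_power2 zero_less_power2)
  qed
  then show ?thesis
    using True s by (simp add: Omega_def positive_definite_def x schur_def)
qed (simp add: Omega_def)

lemma Omega_subset_V: "Omega \<subseteq> V"
  by (auto simp: Omega_def)

text \<open>The product L L^T for L the exponential of the lower half, multiplied out. The lower
  half carries half the diagonal, hence the 1/2 inside \<open>psi\<close>, while exp (a / 2) squared
  is exp a.\<close>

definition exp_coord :: "real^3^3 \<Rightarrow> real^3^3" where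
  "exp_coord A = sym_mat (exp (A$1$1)) (exp (A$2$2))
     (exp (A$3$3) + exp (A$1$1) * (A$3$1 * psi ((A$3$3 - A$1$1) / 2))^2
        + exp (A$2$2) * (A$3$2 * psi ((A$3$3 - A$2$2) / 2))^2)
     (exp (A$1$1) * (A$3$1 * psi ((A$3$3 - A$1$1) / 2)))
     (exp (A$2$2) * (A$3$2 * psi ((A$3$3 - A$2$2) / 2)))"

text \<open>Obtained by solving \<open>exp_coord\<close> from the top: two diagonal entries give the
  first logarithms, the Schur complement gives the third, and division by the positive
  \<open>psi\<close> recovers the bottom row.\<close>

definition log_coord :: "real^3^3 \<Rightarrow> real^3^3" where
  "log_coord A = sym_mat (ln (A$1$1)) (ln (A$2$2)) (ln (schur A))
     (A$3$1 * inverse (A$1$1) * inverse (psi ((ln (schur A) - ln (A$1$1)) / 2)))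
     (A$3$2 * inverse (A$2$2) * inverse (psi ((ln (schur A) - ln (A$2$2)) / 2)))"

lemma exp_half_squared: "(exp (x / 2))\<^sup>2 = exp (x :: real)" "exp (x / 2) * exp (x / 2) = exp x"
  by (simp_all add: power2_eq_square flip: exp_add)

lemma Exp_Delta_eq:
  assumes "v \<in> V"
  shows "Exp_Delta v = exp_coord v"
proof -
  obtain a b e c d where v: "v = sym_mat a b e c d"
    using assms by (rule V_cases)
  show ?thesis
    by (simp add: v Exp_Delta_def lower_half_sym_mat mat_exp_low_mat low_mat_mult_transpose exp_coord_def
       power_mult_distrib exp_half_squared diff_divide_distrib mult_ac)
qed

text \<open>The exponential of the lower half is triangular with positive diagonal, hence it is the
  Cholesky factor, and its principal logarithm is the lower half again.\<close>

lemma Log_Exp: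
  assumes "v \<in> V"
  shows "Log_Delta (Exp_Delta v) = v"
proof -
  obtain a b e c d where v: "v = sym_mat a b e c d"
    using assms by (rule V_cases)
  let ?L = "low_mat (a / 2) (b / 2) (e / 2) c d"
  have "cholesky (Exp_Delta v) = mat_exp ?L"
    unfolding v Exp_Delta_def lower_half_sym_mat unfolding mat_exp_low_mat
    by (rule cholesky_low_mat) simp_all
  then show ?thesis
    by (simp add: Log_Delta_def mat_log_low_mat) (simp add: v mat3_eq_iff transpose_def)
qed

lemma exp_coord_in_Omega: "exp_coord v \<in> Omega"
  by (simp add: Omega_iff exp_coord_def schur_def power2_eq_square)

lemma exp_log_coord:
  assumes "x \<in> Omega"
  shows "exp_coord (log_coord x) = x"
proof -
  have "x \<in> V" and pos: "x$1$1 > 0" "x$2$2 > 0" "schur x > 0"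
    using assms by (auto simp: Omega_iff)
  then have x: "x = sym_mat (x$1$1) (x$2$2) (x$3$3) (x$3$1) (x$3$2)"
    using V_iff by blast
  have "exp_coord (log_coord x) = sym_mat (x$1$1) (x$2$2) (x$3$3) (x$3$1) (x$3$2)"
    using pos by (simp add: exp_coord_def log_coord_def) (simp add: schur_def power2_eq_square field_simps)
  with x show ?thesis by simp
qed

lemma log_coord_in_V: "log_coord x \<in> V"
  by (simp add: log_coord_def)

text \<open>Since the exponential maps \<open>log_coord x\<close> to x, applying
  \<open>Log_Exp\<close> to \<open>log_coord x\<close> evaluates the logarithm at x without
  computing \<open>cholesky\<close> or \<open>mat_log\<close> there.\<close>

lemma Log_Delta_eq:
  assumes "x \<in> Omega"
  shows "Log_Delta x = log_coord x"
  using Log_Exp[OF log_coord_in_V[of x]] assms by (simp add: Exp_Delta_eq log_coord_in_V exp_log_coord)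

lemma Exp_Log: "x \<in> Omega \<Longrightarrow> Exp_Delta (Log_Delta x) = x"
  by (simp add: Log_Delta_eq Exp_Delta_eq log_coord_in_V exp_log_coord)

lemma Exp_in_Omega: "v \<in> V \<Longrightarrow> Exp_Delta v \<in> Omega"
  by (simp add: Exp_Delta_eq exp_coord_in_Omega)

lemma Log_in_V: "x \<in> Omega \<Longrightarrow> Log_Delta x \<in> V"
  by (simp add: Log_Delta_eq log_coord_in_V)

subsection \<open>The trace form\<close>

lemma clan_sym_mat: "clan (sym_mat a b e c d) (sym_mat a' b' e' c' d')
    = sym_mat (a * a') (b * b') (2 * (c * c' + d * d') + e * e')
        (c * a' + (a + e) / 2 * c') (d * b' + (b + e) / 2 * d')"
  by (simp add: clan_def lower_half_sym_mat mat3_eq_iff matrix_matrix_mult_def sum_3 transpose_def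
      field_simps)

lemma V_basis_eq: "V_basis = {sym_mat 1 0 0 0 0, sym_mat 0 1 0 0 0, sym_mat 0 0 1 0 0,
    sym_mat 0 0 0 1 0, sym_mat 0 0 0 0 1}"
proof -
  have ax: "axis i (axis j 1) $ k $ l = (if k = i \<and> l = j then 1 else 0)"
    for i j k l :: 3 by (auto simp: axis_def)
  have "axis 1 (axis 1 1) = sym_mat 1 0 0 0 0" "axis 2 (axis 2 1) = sym_mat 0 1 0 0 0"
    "axis 3 (axis 3 1) = sym_mat 0 0 1 0 0"
    "axis 3 (axis 1 1) + axis 1 (axis 3 1) = sym_mat 0 0 0 1 0"
    "axis 3 (axis 2 1) + axis 2 (axis 3 1) = sym_mat 0 0 0 0 1"
    by (simp_all add: mat3_eq_iff ax)
  then show ?thesis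
    by (simp add: V_basis_def)
qed

text \<open>In the five entries on and below the diagonal the basis elements are unit vectors, so
  pairing with E reads off its coefficient.\<close>

lemma representation_V_basis:
  assumes "E \<in> V_basis"
  shows "representation V_basis (sym_mat a b e c d) E
    = a * E$1$1 + b * E$2$2 + e * E$3$3 + c * E$3$1 + d * E$3$2"
proof -
  let ?f = "\<lambda>E. if E \<in> V_basis then a * E$1$1 + b * E$2$2 + e * E$3$3 + c * E$3$1 + d * E$3$2 else 0"
  have "representation V_basis (sym_mat a b e c d) = ?f"
  proof (rule representation_eqI[OF independent_V_basis])
    show "sym_mat a b e c d \<in> span V_basis"
      by (simp add: span_V_basis)
    show "finite {E. ?f E \<noteq> 0}"
      by (rule finite_subset[of _ V_basis]) (auto simp: V_basis_eq)
    have "(\<Sum>E | ?f E \<noteq> 0. ?f E *\<^sub>R E) = (\<Sum>E\<in>V_basis. ?f E *\<^sub>R E)"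
      by (rule sum.mono_neutral_left) (auto simp: V_basis_eq split: if_splits)
    also have "\<dots> = sym_mat a b e c d"
      by (simp add: V_basis_eq sym_mat_scaleR sym_mat_add)
    finally show "(\<Sum>E | ?f E \<noteq> 0. ?f E *\<^sub>R E) = sym_mat a b e c d" .
  qed argo
  with assms show ?thesis by simp
qed

text \<open>The diagonal coefficients of the multiplication operator are a, b, e, (a + e) / 2 and (b
  + e) / 2.\<close>

lemma trace_clan: "trace_wrt V_basis (clan (sym_mat a b e c d)) = 3 / 2 * a + 3 / 2 * b + 2 * e"
proof -
  have "trace_wrt V_basis (clan (sym_mat a b e c d))
      = (\<Sum>E\<in>V_basis. (let w = clan (sym_mat a b e c d) E in
          w$1$1 * E$1$1 + w$2$2 * E$2$2 + w$3$3 * E$3$3 + w$3$1 * E$3$1 + w$3$2 * E$3$2))"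
    unfolding trace_wrt_def
  proof (rule sum.cong)
    fix E assume E: "E \<in> V_basis"
    then obtain a' b' e' c' d' where "E = sym_mat a' b' e' c' d'"
      by (auto simp: V_basis_eq)
    then show "representation V_basis (clan (sym_mat a b e c d) E) E
      = (let w = clan (sym_mat a b e c d) E in
          w$1$1 * E$1$1 + w$2$2 * E$2$2 + w$3$3 * E$3$3 + w$3$1 * E$3$1 + w$3$2 * E$3$2)"
      using E by (simp add: clan_sym_mat representation_V_basis Let_def)
  qed simp
  also have "\<dots> = 3 / 2 * a + 3 / 2 * b + 2 * e"
    by (simp add: V_basis_eq clan_sym_mat Let_def) (simp add: field_simps)
  finally show ?thesis .
qed

text \<open>An isometry from \<open>V\<close> with \<open>Q_Delta\<close> to the Euclidean space of matrices.\<close>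

definition Q_root :: "real^3^3 \<Rightarrow> real^3^3" where
  "Q_root u = sym_mat (sqrt (3 / 2) * u$1$1) (sqrt (3 / 2) * u$2$2) (sqrt 2 * u$3$3)
     (sqrt 2 * u$3$1) (sqrt 2 * u$3$2)"

text \<open>Off-diagonal entries occur twice in the matrix inner product, so their factor sqrt 2
  produces the coefficient 4 of c * c' and d * d'.\<close>

lemma Q_Delta_eq:
  assumes "u \<in> V" "v \<in> V"
  shows "Q_Delta u v = Q_root u \<bullet> Q_root v"
proof -
  obtain a b e c d where u: "u = sym_mat a b e c d"
    using assms(1) by (rule V_cases)
  obtain a' b' e' c' d' where v: "v = sym_mat a' b' e' c' d'"
    using assms(2) by (rule V_cases)
  have "Q_Delta u v = 3 / 2 * (a * a') + 3 / 2 * (b * b') + 2 * (2 * (c * c' + d * d') + e * e')"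
    unfolding Q_Delta_def u v clan_sym_mat trace_clan ..
  also have "\<dots> = Q_root u \<bullet> Q_root v"
    by (simp add: Q_root_def u v inner_vec_def sum_3 real_sqrt_mult_self mult_ac
        algebra_simps)
  finally show ?thesis .
qed

lemma bounded_linear_Q_root: "bounded_linear Q_root"
  unfolding linear_conv_bounded_linear[symmetric]
  by (rule linearI) (simp_all add: Q_root_def sym_mat_add sym_mat_scaleR algebra_simps)

lemma Q_root_eq_0: "u \<in> V \<Longrightarrow> Q_root u = 0 \<longleftrightarrow> u = 0"
  by (auto simp: Q_root_def V_iff mat3_eq_iff)

subsection \<open>Twice differentiable maps\<close>

text \<open>Symmetry of the second derivative is part of the definition, which is stable under the
  operations below; this replaces an appeal to Schwarz's theorem.\<close>

definition second_diff_on :: "'a set \<Rightarrow> ('a::real_normed_vector \<Rightarrow> 'b::real_normed_vector) \<Rightarrow>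
    ('a \<Rightarrow> 'a \<Rightarrow> 'b) \<Rightarrow> ('a \<Rightarrow> 'a \<Rightarrow> 'a \<Rightarrow> 'b) \<Rightarrow> bool" where
  "second_diff_on S f f1 f2 \<longleftrightarrow> (\<forall>x\<in>S. (f has_derivative f1 x) (at x within S) \<and>
     (\<forall>u. ((\<lambda>y. f1 y u) has_derivative f2 x u) (at x within S)) \<and>
     (\<forall>u v. f2 x u v = f2 x v u))"

definition twice_diff_on :: "'a set \<Rightarrow> ('a::real_normed_vector \<Rightarrow> 'b::real_normed_vector) \<Rightarrow> bool" where
  "twice_diff_on S f \<longleftrightarrow> (\<exists>f1 f2. second_diff_on S f f1 f2)"

lemma second_diff_on_bounded_linear:
  assumes "bounded_linear L" "second_diff_on S f f1 f2"
  shows "second_diff_on S (\<lambda>x. L (f x)) (\<lambda>x u. L (f1 x u)) (\<lambda>x u v. L (f2 x u v))"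
  using assms(2) unfolding second_diff_on_def
  by (auto intro: bounded_linear.has_derivative[OF assms(1)])

lemma second_diff_on_cong:
  assumes "second_diff_on S f f1 f2" "\<And>x. x \<in> S \<Longrightarrow> g x = f x"
  shows "second_diff_on S g f1 f2"
  using assms unfolding second_diff_on_def
  by (auto intro: has_derivative_transform[of _ S g f])

lemma twice_diff_on_cong:
  assumes "twice_diff_on S f" "\<And>x. x \<in> S \<Longrightarrow> g x = f x"
  shows "twice_diff_on S g"
  using assms second_diff_on_cong unfolding twice_diff_on_def by metis

lemma twice_diff_on_linear_comp:
  "bounded_linear L \<Longrightarrow> twice_diff_on S f \<Longrightarrow> twice_diff_on S (\<lambda>x. L (f x))"
  unfolding twice_diff_on_def using second_diff_on_bounded_linear by blast

lemma twice_diff_on_linear: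
  assumes "bounded_linear L"
  shows "twice_diff_on S L"
proof -
  have "second_diff_on S L (\<lambda>_. L) (\<lambda>_ _ _. 0)"
    by (auto simp: second_diff_on_def bounded_linear_imp_has_derivative assms)
  then show ?thesis by (auto simp: twice_diff_on_def)
qed

lemma twice_diff_on_add:
  assumes "twice_diff_on S f" "twice_diff_on S g"
  shows "twice_diff_on S (\<lambda>x. f x + g x)"
proof -
  obtain f1 f2 g1 g2 where fg: "second_diff_on S f f1 f2" "second_diff_on S g g1 g2"
    using assms by (auto simp: twice_diff_on_def)
  have "second_diff_on S (\<lambda>x. f x + g x) (\<lambda>x u. f1 x u + g1 x u) (\<lambda>x u v. f2 x u v + g2 x u v)"
    using fg by (auto simp: second_diff_on_def intro!: has_derivative_add)
  then show ?thesis by (auto simp: twice_diff_on_def)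
qed

lemma twice_diff_on_mult:
  fixes f g :: "'a::real_normed_vector \<Rightarrow> real"
  assumes "twice_diff_on S f" "twice_diff_on S g"
  shows "twice_diff_on S (\<lambda>x. f x * g x)"
proof -
  obtain f1 f2 g1 g2 where fg: "second_diff_on S f f1 f2" "second_diff_on S g g1 g2"
    using assms by (auto simp: twice_diff_on_def)
  have "second_diff_on S (\<lambda>x. f x * g x) (\<lambda>x u. f x * g1 x u + f1 x u * g x)
     (\<lambda>x u v. (f x * g2 x u v + f1 x v * g1 x u) + (f1 x u * g1 x v + f2 x u v * g x))"
    using fg by (auto simp: second_diff_on_def intro!: has_derivative_add has_derivative_mult)
  then show ?thesis by (auto simp: twice_diff_on_def)
qed

definition twice_diff_real :: "real set \<Rightarrow> (real \<Rightarrow> real) \<Rightarrow> bool" where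
  "twice_diff_real J h \<longleftrightarrow> (\<exists>h1 h2. \<forall>y\<in>J.
     (h has_real_derivative h1 y) (at y) \<and> (h1 has_real_derivative h2 y) (at y))"

lemma twice_diff_on_compose:
  fixes f :: "'a::real_normed_vector \<Rightarrow> real"
  assumes "twice_diff_real J h" "twice_diff_on S f" "\<And>x. x \<in> S \<Longrightarrow> f x \<in> J"
  shows "twice_diff_on S (\<lambda>x. h (f x))"
proof -
  obtain f1 f2 where f: "second_diff_on S f f1 f2"
    using assms by (auto simp: twice_diff_on_def)
  obtain h1 h2 where h: "\<And>y. y \<in> J \<Longrightarrow> (h has_real_derivative h1 y) (at y)"
    "\<And>y. y \<in> J \<Longrightarrow> (h1 has_real_derivative h2 y) (at y)"
    using assms by (auto simp: twice_diff_real_def)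
  have c: "((\<lambda>x. k (f x)) has_derivative (\<lambda>u. k' * f1 x u)) (at x within S)"
    if "x \<in> S" "(k has_real_derivative k') (at (f x))" for k k' x
    using has_derivative_compose[of f "f1 x" x S k "(*) k'"] f that
    by (auto simp: second_diff_on_def has_field_derivative_def)
  have "second_diff_on S (\<lambda>x. h (f x)) (\<lambda>x u. h1 (f x) * f1 x u)
     (\<lambda>x u v. h1 (f x) * f2 x u v + (h2 (f x) * f1 x v) * f1 x u)"
    unfolding second_diff_on_def
  proof (intro ballI conjI allI)
    fix x assume x: "x \<in> S"
    show "((\<lambda>x. h (f x)) has_derivative (\<lambda>u. h1 (f x) * f1 x u)) (at x within S)"
      using c h assms(3) x by blast
    show "((\<lambda>y. h1 (f y) * f1 y u) has_derivative
        (\<lambda>v. h1 (f x) * f2 x u v + (h2 (f x) * f1 x v) * f1 x u)) (at x within S)" for u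
    proof -
      have "((\<lambda>y. h1 (f y)) has_derivative (\<lambda>v. h2 (f x) * f1 x v)) (at x within S)"
        using c h assms(3) x by blast
      moreover have "((\<lambda>y. f1 y u) has_derivative f2 x u) (at x within S)"
        using f x by (simp add: second_diff_on_def)
      ultimately show ?thesis
        by (rule has_derivative_mult)
    qed
    show "h1 (f x) * f2 x u v + (h2 (f x) * f1 x v) * f1 x u
       = h1 (f x) * f2 x v u + (h2 (f x) * f1 x u) * f1 x v" for u v
      using f x by (simp add: second_diff_on_def)
  qed
  then show ?thesis by (auto simp: twice_diff_on_def)
qed

lemma twice_diff_real_exp: "twice_diff_real UNIV exp"
  unfolding twice_diff_real_def
  by (rule exI[of _ exp], rule exI[of _ exp]) (auto intro!: derivative_eq_intros)

lemma twice_diff_real_ln: "twice_diff_real {0<..} ln"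
  unfolding twice_diff_real_def
  by (rule exI[of _ "\<lambda>x. inverse x"], rule exI[of _ "\<lambda>x. - (inverse x * inverse x)"])
     (auto intro!: derivative_eq_intros simp: power2_eq_square divide_inverse)

lemma twice_diff_real_inverse: "twice_diff_real {0<..} inverse"
  unfolding twice_diff_real_def
  by (rule exI[of _ "\<lambda>x. - (inverse x * inverse x)"], rule exI[of _ "\<lambda>x. 2 * inverse x ^ 3"])
     (auto intro!: derivative_eq_intros simp: power2_eq_square power3_eq_cube)

text \<open>The case split in \<open>psi\<close> hides an entire function with coefficients 1 / (n +
  1)!, read off from the divided difference at 0 and u.\<close>

lemma twice_diff_real_psi: "twice_diff_real UNIV psi"
proof -
  define c :: "nat \<Rightarrow> real" where "c n = inverse (fact (Suc n))" for n
  have psi: "(\<lambda>n. c n * u ^ n) sums psi u" for u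
  proof -
    have "(\<lambda>n. div_pow 0 u (Suc n) / fact (Suc n)) sums psi u"
      using div_pow_sums[of 0 u] by (subst sums_Suc_iff) simp
    moreover have "div_pow 0 u (Suc n) = u ^ n" for n
      by (induction n) simp_all
    ultimately show ?thesis
      by (simp add: c_def divide_inverse mult.commute del: fact_Suc div_pow.simps)
  qed
  have s0: "summable (\<lambda>n. c n * u ^ n)" for u
    using psi sums_summable by blast
  have s1: "summable (\<lambda>n. diffs c n * u ^ n)" for u
    by (rule termdiff_converges_all) (rule s0)
  have eq: "psi = (\<lambda>u. \<Sum>n. c n * u ^ n)"
    using psi by (auto simp: sums_iff fun_eq_iff)
  show ?thesis
    unfolding twice_diff_real_def eq
    by (rule exI[of _ "\<lambda>u. \<Sum>n. diffs c n * u ^ n"],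
        rule exI[of _ "\<lambda>u. \<Sum>n. diffs (diffs c) n * u ^ n"])
      (intro ballI conjI termdiffs_strong_converges_everywhere s0 s1)
qed

lemma twice_diff_on_sym_mat:
  assumes "twice_diff_on S a" "twice_diff_on S b" "twice_diff_on S e" "twice_diff_on S c" "twice_diff_on S d"
  shows "twice_diff_on S (\<lambda>x. sym_mat (a x) (b x) (e x) (c x) (d x))"
proof -
  have "(\<lambda>x. sym_mat (a x) (b x) (e x) (c x) (d x)) = (\<lambda>x. a x *\<^sub>R sym_mat 1 0 0 0 0 + b x *\<^sub>R sym_mat 0 1 0 0 0
      + e x *\<^sub>R sym_mat 0 0 1 0 0 + c x *\<^sub>R sym_mat 0 0 0 1 0 + d x *\<^sub>R sym_mat 0 0 0 0 1)"
    by (simp add: sym_mat_add sym_mat_scaleR)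
  then show ?thesis
    by (simp only:) (intro twice_diff_on_add assms[THEN twice_diff_on_linear_comp[OF bounded_linear_scaleR_left]])
qed

lemma twice_diff_on_entry: "twice_diff_on S (\<lambda>A::real^3^3. A $ i $ j)"
  by (intro twice_diff_on_linear bounded_linear_compose[OF bounded_linear_vec_nth bounded_linear_vec_nth])

lemma twice_diff_on_cmult:
  fixes f :: "'a::real_normed_vector \<Rightarrow> real"
  shows "twice_diff_on S f \<Longrightarrow> twice_diff_on S (\<lambda>x. r * f x)"
  by (rule twice_diff_on_linear_comp[OF bounded_linear_mult_right])

lemma twice_diff_on_diff:
  fixes f g :: "'a::real_normed_vector \<Rightarrow> real"
  assumes "twice_diff_on S f" "twice_diff_on S g"
  shows "twice_diff_on S (\<lambda>x. f x - g x)"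
  using twice_diff_on_add[OF assms(1) twice_diff_on_cmult[OF assms(2), of "-1"]] by simp

lemma twice_diff_on_exp_coord: "twice_diff_on S exp_coord"
proof -
  have e: "twice_diff_on S (\<lambda>A::real^3^3. exp (A$k$k))" for k
    by (rule twice_diff_on_compose[OF twice_diff_real_exp twice_diff_on_entry]) simp
  have p: "twice_diff_on S (\<lambda>A::real^3^3. A$3$k * psi (1 / 2 * (A$3$3 - A$k$k)))" for k
    by (rule twice_diff_on_mult[OF twice_diff_on_entry twice_diff_on_compose[OF twice_diff_real_psi
          twice_diff_on_cmult[OF twice_diff_on_diff[OF twice_diff_on_entry twice_diff_on_entry]]]]) simp
  have ep: "twice_diff_on S (\<lambda>A::real^3^3. exp (A$k$k) * (A$3$k * psi (1 / 2 * (A$3$3 - A$k$k))))"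
    and epp: "twice_diff_on S (\<lambda>A::real^3^3. exp (A$k$k) *
        ((A$3$k * psi (1 / 2 * (A$3$3 - A$k$k))) * (A$3$k * psi (1 / 2 * (A$3$3 - A$k$k)))))" for k
    by (rule twice_diff_on_mult[OF e p], rule twice_diff_on_mult[OF e twice_diff_on_mult[OF p p]])
  have eq: "exp_coord = (\<lambda>A. sym_mat (exp (A$1$1)) (exp (A$2$2))
     (exp (A$3$3) + exp (A$1$1) * ((A$3$1 * psi (1 / 2 * (A$3$3 - A$1$1))) * (A$3$1 * psi (1 / 2 * (A$3$3 - A$1$1))))
        + exp (A$2$2) * ((A$3$2 * psi (1 / 2 * (A$3$3 - A$2$2))) * (A$3$2 * psi (1 / 2 * (A$3$3 - A$2$2)))))
     (exp (A$1$1) * (A$3$1 * psi (1 / 2 * (A$3$3 - A$1$1))))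
     (exp (A$2$2) * (A$3$2 * psi (1 / 2 * (A$3$3 - A$2$2)))))"
    by (simp add: exp_coord_def fun_eq_iff power2_eq_square)
  show ?thesis
    by (subst eq) (intro twice_diff_on_sym_mat twice_diff_on_add e ep epp)
qed

lemma twice_diff_on_log_coord: "twice_diff_on Omega log_coord"
proof -
  note c = twice_diff_on_compose[OF twice_diff_real_ln] twice_diff_on_compose[OF twice_diff_real_inverse]
  have inv: "twice_diff_on Omega (\<lambda>A. inverse (A$k$k))"
    and lnk: "twice_diff_on Omega (\<lambda>A. ln (A$k$k))" if "k = 1 \<or> k = 2" for k
    by (rule c, rule twice_diff_on_entry, use that in \<open>auto simp: Omega_iff\<close>)+
  have sq: "twice_diff_on Omega (\<lambda>A. (A$3$k * A$3$k) * inverse (A$k$k))" if "k = 1 \<or> k = 2" for k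
    by (rule twice_diff_on_mult[OF twice_diff_on_mult[OF twice_diff_on_entry twice_diff_on_entry] inv[OF that]])
  have eq: "schur = (\<lambda>A. A$3$3 - (A$3$1 * A$3$1) * inverse (A$1$1) - (A$3$2 * A$3$2) * inverse (A$2$2))"
    by (simp add: schur_def fun_eq_iff divide_inverse power2_eq_square)
  have schur: "twice_diff_on Omega schur"
    by (subst eq) (intro twice_diff_on_diff twice_diff_on_entry sq; simp)
  have ln: "twice_diff_on Omega (\<lambda>A. ln (schur A))"
    by (rule c, rule schur) (simp add: Omega_iff)
  have psi: "twice_diff_on Omega (\<lambda>A. inverse (psi (1 / 2 * (ln (schur A) - ln (A$k$k)))))"
    if "k = 1 \<or> k = 2" for k
    by (rule c, rule twice_diff_on_compose[OF twice_diff_real_psi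
        twice_diff_on_cmult[OF twice_diff_on_diff[OF ln lnk[OF that]]]]) (simp_all add: psi_pos)
  have off: "twice_diff_on Omega (\<lambda>A. A$3$k * inverse (A$k$k) * inverse (psi (1 / 2 * (ln (schur A) - ln (A$k$k)))))"
    if "k = 1 \<or> k = 2" for k
    by (rule twice_diff_on_mult[OF twice_diff_on_mult[OF twice_diff_on_entry inv[OF that]] psi[OF that]])
  have eq: "log_coord = (\<lambda>A. sym_mat (ln (A$1$1)) (ln (A$2$2)) (ln (schur A))
     (A$3$1 * inverse (A$1$1) * inverse (psi (1 / 2 * (ln (schur A) - ln (A$1$1)))))
     (A$3$2 * inverse (A$2$2) * inverse (psi (1 / 2 * (ln (schur A) - ln (A$2$2))))))"
    by (simp add: log_coord_def fun_eq_iff)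
  show ?thesis
    by (subst eq) (intro twice_diff_on_sym_mat lnk ln off; simp)
qed

definition proj_V :: "real^3^3 \<Rightarrow> real^3^3" where
  "proj_V A = sym_mat (A$1$1) (A$2$2) (A$3$3) (A$3$1) (A$3$2)"

lemma proj_V_in_V [simp]: "proj_V A \<in> V"
  by (simp add: proj_V_def)

lemma V_iff_proj_V: "A \<in> V \<longleftrightarrow> proj_V A = A"
  by (metis V_iff proj_V_def)

lemma bounded_linear_proj_V: "bounded_linear proj_V"
  unfolding linear_conv_bounded_linear[symmetric]
  by (rule linearI) (simp_all add: proj_V_def sym_mat_add sym_mat_scaleR)

text \<open>Along directions that leave \<open>S\<close>, a derivative within \<open>S\<close> may
  take values outside \<open>V\<close>. Composing with \<open>proj_V\<close> leaves f unchanged on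
  \<open>S\<close> and puts all values into \<open>V\<close>.\<close>

lemma twice_diff_on_V_valued:
  assumes "twice_diff_on S f" "\<And>x. x \<in> S \<Longrightarrow> f x \<in> V"
  obtains f1 f2 where "second_diff_on S f f1 f2" "\<And>x u. f1 x u \<in> V" "\<And>x u v. f2 x u v \<in> V"
proof -
  obtain f1 f2 where "second_diff_on S f f1 f2"
    using assms by (auto simp: twice_diff_on_def)
  from second_diff_on_bounded_linear[OF bounded_linear_proj_V this]
  have "second_diff_on S f (\<lambda>x u. proj_V (f1 x u)) (\<lambda>x u v. proj_V (f2 x u v))"
    by (rule second_diff_on_cong) (use assms(2) in \<open>simp add: V_iff_proj_V\<close>)
  with that show thesis by simp
qed

subsection \<open>Derivatives within the cone\<close>

lemma at_within_neq_bot: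
  fixes a :: "'a::perfect_space"
  assumes "\<forall>\<^sub>F t in at a. t \<in> T"
  shows "at a within T \<noteq> bot"
proof
  assume "at a within T = bot"
  then have "\<forall>\<^sub>F t in at a within T. False"
    by simp
  then have "\<forall>\<^sub>F t in nhds a. t \<noteq> a \<longrightarrow> t \<in> T \<longrightarrow> False"
    unfolding eventually_at_filter .
  moreover have "\<forall>\<^sub>F t in nhds a. t \<noteq> a \<longrightarrow> t \<in> T"
    using assms unfolding eventually_at_filter by simp
  ultimately have "\<forall>\<^sub>F t in nhds a. t \<noteq> a \<longrightarrow> False"
    by eventually_elim blast
  then have "\<forall>\<^sub>F t in at a. False"
    unfolding eventually_at_filter by simp
  then show False by simp
qed

text \<open>Restriction to the line through x in direction v leaves a one-variable derivative,
  unique because 0 is a limit point of the admissible parameters.\<close>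

lemma has_derivative_unique_direction:
  assumes "(f has_derivative f1) (at x within S)" "(f has_derivative f2) (at x within S)"
    and ev: "\<forall>\<^sub>F t in at (0::real). x + t *\<^sub>R v \<in> S"
  shows "f1 v = f2 v"
proof -
  define T where "T = {t. x + t *\<^sub>R v \<in> S}"
  have d: "((\<lambda>t. f (x + t *\<^sub>R v)) has_vector_derivative f' v) (at 0 within T)"
    if "(f has_derivative f') (at x within S)" for f'
  proof -
    have "((\<lambda>t. x + t *\<^sub>R v) has_derivative (\<lambda>t. t *\<^sub>R v)) (at 0 within T)"
      by (auto intro!: derivative_eq_intros)
    moreover have "(f has_derivative f') (at (x + 0 *\<^sub>R v) within (\<lambda>t. x + t *\<^sub>R v) ` T)"
      using that by (auto intro: has_derivative_subset simp: T_def)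
    ultimately have "((\<lambda>t. f (x + t *\<^sub>R v)) has_derivative (\<lambda>t. f' (t *\<^sub>R v))) (at 0 within T)"
      by (rule has_derivative_in_compose)
    then show ?thesis
      using has_derivative_linear[OF that] by (simp add: has_vector_derivative_def linear_cmul)
  qed
  have "at 0 within T \<noteq> bot"
    using ev by (intro at_within_neq_bot) (simp add: T_def)
  then show ?thesis
    using d[OF assms(1)] d[OF assms(2)] by (rule vector_derivative_unique_within)
qed

lemma frechet_derivative_direction:
  assumes "(f has_derivative f') (at x within S)" "\<forall>\<^sub>F t in at (0::real). x + t *\<^sub>R v \<in> S"
  shows "frechet_derivative f (at x within S) v = f' v"
  using frechet_derivative_works[THEN iffD1, OF differentiableI[OF assms(1)]] assms
  by (rule has_derivative_unique_direction)

lemma V_direction: "x \<in> V \<Longrightarrow> v \<in> V \<Longrightarrow> \<forall>\<^sub>F t in at (0::real). x + t *\<^sub>R v \<in> V"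
  by (simp add: subspace_V subspace_add subspace_scale)

text \<open>Openness of the cone in \<open>V\<close>, tested along lines: the strict inequalities of
  \<open>Omega_iff\<close> persist by continuity.\<close>

lemma Omega_direction:
  assumes x: "x \<in> Omega" and v: "v \<in> V"
  shows "\<forall>\<^sub>F t in at (0::real). x + t *\<^sub>R v \<in> Omega"
proof -
  let ?p = "\<lambda>t. x + t *\<^sub>R v"
  have pos: "x$1$1 > 0" "x$2$2 > 0" "schur x > 0" and xV: "x \<in> V"
    using x by (auto simp: Omega_iff)
  have e: "((\<lambda>t. ?p t $ i $ j) \<longlongrightarrow> x $ i $ j) (at 0)" for i j
  proof -
    have "((\<lambda>t. x $ i $ j + t * v $ i $ j) \<longlongrightarrow> x $ i $ j + 0 * v $ i $ j) (at 0)"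
      by (intro tendsto_intros)
    then show ?thesis by simp
  qed
  have "((\<lambda>t. schur (?p t)) \<longlongrightarrow> schur x) (at 0)"
    unfolding schur_def using pos by (intro tendsto_intros e) auto
  then have "\<forall>\<^sub>F t in at 0. schur (?p t) > 0"
    using pos order_tendstoD(1) by blast
  moreover have "\<forall>\<^sub>F t in at 0. ?p t $ 1 $ 1 > 0" "\<forall>\<^sub>F t in at 0. ?p t $ 2 $ 2 > 0"
    using pos order_tendstoD(1)[OF e] by blast+
  moreover have "\<forall>\<^sub>F t in at 0. ?p t \<in> V"
    using V_direction xV v by blast
  ultimately show ?thesis
    by eventually_elim (simp only: Omega_iff simp_thms)
qed

lemma has_vector_derivative_compose_curve:
  assumes "(f has_derivative f') (at (c t) within S)" "c ` I \<subseteq> S" "(c has_vector_derivative c') (at t within I)"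
  shows "((\<lambda>s. f (c s)) has_vector_derivative f' c') (at t within I)"
proof -
  have "((\<lambda>s. f (c s)) has_derivative (\<lambda>h. f' (h *\<^sub>R c'))) (at t within I)"
    using assms unfolding has_vector_derivative_def
    by (intro has_derivative_in_compose[of c _ t I f f']) (auto intro: has_derivative_subset)
  then show ?thesis
    using has_derivative_linear[OF assms(1)] by (simp add: has_vector_derivative_def linear_cmul)
qed

lemma linear_sum_Basis:
  fixes f :: "'a::euclidean_space \<Rightarrow> 'b::real_vector"
  assumes "linear f"
  shows "(\<Sum>b\<in>Basis. (u \<bullet> b) *\<^sub>R f b) = f u"
proof -
  have "f u = f (\<Sum>b\<in>Basis. (u \<bullet> b) *\<^sub>R b)"
    by (simp add: euclidean_representation)
  then show ?thesis
    using assms by (simp add: linear_sum linear_cmul)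
qed

lemma second_diff_on_linear:
  assumes "second_diff_on S f f1 f2" "x \<in> S"
  shows "linear (f1 x)" "linear (f2 x u)" "linear (\<lambda>u. f2 x u v)"
proof -
  show "linear (f1 x)" and l: "linear (f2 x u)" for u
    using assms unfolding second_diff_on_def by (blast intro: has_derivative_linear)+
  \<comment> \<open>Linearity in the first direction is inherited from the second one through
    symmetry.\<close>
  have "(\<lambda>u. f2 x u v) = f2 x v"
    using assms by (auto simp: second_diff_on_def)
  then show "linear (\<lambda>u. f2 x u v)"
    using l[of v] by simp
qed

text \<open>Differentiability of \<open>f1\<close> is given for a fixed direction only. Expanding c'
  in a basis makes f1 (c s) (c' s) a finite sum to which the product rule applies.\<close>

lemma second_diff_on_curve:
  fixes f :: "'a::euclidean_space \<Rightarrow> 'b::real_normed_vector"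
  assumes f: "second_diff_on S f f1 f2" and c: "c ` I \<subseteq> S" and t: "t \<in> I"
    and c1: "(c has_vector_derivative c' t) (at t within I)"
    and c2: "(c' has_vector_derivative c'') (at t within I)"
  shows "((\<lambda>s. f1 (c s) (c' s)) has_vector_derivative
           f2 (c t) (c' t) (c' t) + f1 (c t) c'') (at t within I)"
proof -
  have ct: "c s \<in> S" if "s \<in> I" for s using c that by auto
  have "((\<lambda>s. \<Sum>b\<in>Basis. (c' s \<bullet> b) *\<^sub>R f1 (c s) b) has_vector_derivative
      (\<Sum>b\<in>Basis. (c' t \<bullet> b) *\<^sub>R f2 (c t) b (c' t) + (c'' \<bullet> b) *\<^sub>R f1 (c t) b)) (at t within I)"
  proof (intro has_vector_derivative_sum has_vector_derivative_scaleR)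
    fix b
    show "((\<lambda>s. c' s \<bullet> b) has_real_derivative c'' \<bullet> b) (at t within I)"
      using bounded_linear.has_vector_derivative[OF bounded_linear_inner_left c2]
      by (simp add: has_real_derivative_iff_has_vector_derivative)
    show "((\<lambda>s. f1 (c s) b) has_vector_derivative f2 (c t) b (c' t)) (at t within I)"
      using f ct[OF t]
      by (intro has_vector_derivative_compose_curve[where f = "\<lambda>y. f1 y b" and f' = "f2 (c t) b", OF _ c c1])
        (simp add: second_diff_on_def)
  qed
  also have "(\<Sum>b\<in>Basis. (c' t \<bullet> b) *\<^sub>R f2 (c t) b (c' t) + (c'' \<bullet> b) *\<^sub>R f1 (c t) b)
      = f2 (c t) (c' t) (c' t) + f1 (c t) c''"
    using second_diff_on_linear[OF f ct[OF t]] by (simp add: sum.distrib linear_sum_Basis)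
  finally show ?thesis
    by (rule has_vector_derivative_transform[OF t, rotated])
       (use second_diff_on_linear(1)[OF f ct] in \<open>simp add: linear_sum_Basis\<close>)
qed

lemma V_valued_vector_derivative:
  assumes "(c has_vector_derivative c') (at t within I)" "c ` I \<subseteq> V" "t \<in> I" "at t within I \<noteq> bot"
  shows "c' \<in> V"
proof -
  have "((\<lambda>s. proj_V (c s)) has_vector_derivative proj_V c') (at t within I)"
    by (rule bounded_linear.has_vector_derivative[OF bounded_linear_proj_V assms(1)])
  then have "(c has_vector_derivative proj_V c') (at t within I)"
    by (rule has_vector_derivative_transform[OF assms(3), rotated])
       (use assms(2) V_iff_proj_V in auto)
  then have "c' = proj_V c'"
    using assms vector_derivative_unique_within by blast
  then show ?thesis
    using V_iff_proj_V by metis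
qed

subsection \<open>The two connections in logarithmic coordinates\<close>

text \<open>Fixes derivatives to stand in for the choices \<open>dLog_Delta\<close> and
  \<open>dExp_Delta\<close>, with which they are shown to agree on \<open>V\<close>. Values in
  \<open>V\<close> for all arguments keep the side conditions trivial.\<close>

locale log_chart =
  fixes dL d2L dE d2E
  assumes dL: "second_diff_on Omega Log_Delta dL d2L"
    and dL_V [simp]: "dL x u \<in> V" and d2L_V [simp]: "d2L x u v \<in> V"
    and dE: "second_diff_on V Exp_Delta dE d2E"
    and dE_V [simp]: "dE x u \<in> V" and d2E_V [simp]: "d2E x u v \<in> V"

lemma log_chart_exists: "\<exists>dL d2L dE d2E. log_chart dL d2L dE d2E"
proof -
  have "twice_diff_on Omega Log_Delta"
    by (rule twice_diff_on_cong[OF twice_diff_on_log_coord]) (rule Log_Delta_eq)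
  then obtain dL d2L
    where L: "second_diff_on Omega Log_Delta dL d2L" "\<And>x u. dL x u \<in> V" "\<And>x u v. d2L x u v \<in> V"
    by (rule twice_diff_on_V_valued[OF _ Log_in_V]) (assumption, rule that)
  have "twice_diff_on V Exp_Delta"
    by (rule twice_diff_on_cong[OF twice_diff_on_exp_coord]) (rule Exp_Delta_eq)
  then obtain dE d2E
    where E: "second_diff_on V Exp_Delta dE d2E" "\<And>x u. dE x u \<in> V" "\<And>x u v. d2E x u v \<in> V"
    by (rule twice_diff_on_V_valued[OF _ subsetD[OF Omega_subset_V Exp_in_Omega]]) (assumption, rule that)
  have "log_chart dL d2L dE d2E"
    unfolding log_chart_def by (intro conjI allI L E)
  then show ?thesis by blast
qed

context log_chart
begin

lemma Log_has_derivative: "x \<in> Omega \<Longrightarrow> (Log_Delta has_derivative dL x) (at x within Omega)"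
  and dL_has_derivative: "x \<in> Omega \<Longrightarrow> ((\<lambda>y. dL y u) has_derivative d2L x u) (at x within Omega)"
  and d2L_sym: "x \<in> Omega \<Longrightarrow> d2L x u v = d2L x v u"
  using dL by (auto simp: second_diff_on_def)

lemma Exp_has_derivative: "v \<in> V \<Longrightarrow> (Exp_Delta has_derivative dE v) (at v within V)"
  using dE by (auto simp: second_diff_on_def)

lemmas linear_dL = second_diff_on_linear(1)[OF dL]
  and linear_d2L = second_diff_on_linear(2)[OF dL]
  and linear_dE = second_diff_on_linear(1)[OF dE]

lemma dLog_Delta_eq: "x \<in> Omega \<Longrightarrow> u \<in> V \<Longrightarrow> dLog_Delta x u = dL x u"
  unfolding dLog_Delta_def by (intro frechet_derivative_direction Log_has_derivative Omega_direction)

lemma dExp_Delta_eq: "v \<in> V \<Longrightarrow> u \<in> V \<Longrightarrow> dExp_Delta v u = dE v u"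
  unfolding dExp_Delta_def by (intro frechet_derivative_direction Exp_has_derivative V_direction)

lemma has_derivative_comp_Exp:
  assumes "v \<in> V" "(f has_derivative f') (at (Exp_Delta v) within Omega)"
  shows "((\<lambda>v. f (Exp_Delta v)) has_derivative (\<lambda>h. f' (dE v h))) (at v within V)"
  using assms Exp_in_Omega
  by (intro has_derivative_in_compose[OF Exp_has_derivative]) (auto intro: has_derivative_subset)

lemma dL_dE:
  assumes "v \<in> V" "u \<in> V"
  shows "dL (Exp_Delta v) (dE v u) = u"
proof -
  have "((\<lambda>v. Log_Delta (Exp_Delta v)) has_derivative (\<lambda>h. dL (Exp_Delta v) (dE v h))) (at v within V)"
    using assms by (intro has_derivative_comp_Exp Log_has_derivative Exp_in_Omega)
  moreover have "((\<lambda>v. Log_Delta (Exp_Delta v)) has_derivative (\<lambda>h. h)) (at v within V)"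
    by (rule has_derivative_transform[OF assms(1) _ has_derivative_ident]) (simp add: Log_Exp)
  ultimately show ?thesis
    by (rule has_derivative_unique_direction) (intro V_direction assms)
qed

lemma dE_dL:
  assumes "x \<in> Omega" "u \<in> V"
  shows "dE (Log_Delta x) (dL x u) = u"
proof -
  have "((\<lambda>x. Exp_Delta (Log_Delta x)) has_derivative (\<lambda>h. dE (Log_Delta x) (dL x h))) (at x within Omega)"
    using assms Log_in_V
    by (intro has_derivative_in_compose[OF Log_has_derivative])
       (auto intro: has_derivative_subset Exp_has_derivative)
  moreover have "((\<lambda>x. Exp_Delta (Log_Delta x)) has_derivative (\<lambda>h. h)) (at x within Omega)"
    by (rule has_derivative_transform[OF assms(1) _ has_derivative_ident]) (simp add: Exp_Log)
  ultimately show ?thesis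
    by (rule has_derivative_unique_direction) (intro Omega_direction assms)
qed

lemma dL_dE': "x \<in> Omega \<Longrightarrow> u \<in> V \<Longrightarrow> dL x (dE (Log_Delta x) u) = u"
  using dL_dE[OF Log_in_V] by (simp add: Exp_Log)

text \<open>In the chart the constant field w becomes v -> dL (Exp v) w. Its derivative along dL u
  is d2L w (dE (dL u)) = d2L w u, which \<open>dE\<close> carries back to the cone.\<close>

lemma Gamma_nabla_eq:
  assumes x: "x \<in> Omega" and u: "u \<in> V" and w: "w \<in> V"
  shows "Gamma_nabla x u w = dE (Log_Delta x) (d2L x w u)"
proof -
  let ?v = "Log_Delta x"
  have v: "?v \<in> V" using Log_in_V x by blast
  have "((\<lambda>v. dL (Exp_Delta v) w) has_derivative (\<lambda>h. d2L (Exp_Delta ?v) w (dE ?v h))) (at ?v within V)"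
    by (intro has_derivative_comp_Exp v dL_has_derivative Exp_in_Omega)
  then have "((\<lambda>v. dLog_Delta (Exp_Delta v) w) has_derivative (\<lambda>h. d2L (Exp_Delta ?v) w (dE ?v h))) (at ?v within V)"
    by (rule has_derivative_transform[OF v, rotated]) (simp add: dLog_Delta_eq Exp_in_Omega w)
  then have "frechet_derivative (\<lambda>v. dLog_Delta (Exp_Delta v) w) (at ?v within V) (dL x u) = d2L x w (dE ?v (dL x u))"
    by (simp add: frechet_derivative_direction V_direction v Exp_Log x)
  then show ?thesis
    by (simp add: Gamma_nabla_def nabla_Delta_def push_Exp_def D_flat_def push_Log_def[abs_def] Exp_Log
        dLog_Delta_eq dExp_Delta_eq dE_dL assms v)
qed

lemma g_Delta_eq:
  "x \<in> Omega \<Longrightarrow> u \<in> V \<Longrightarrow> w \<in> V \<Longrightarrow> g_Delta x u w = Q_root (dL x u) \<bullet> Q_root (dL x w)"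
  by (simp add: g_Delta_def dLog_Delta_eq Q_Delta_eq)

lemma g_Delta_self_eq_0:
  assumes "x \<in> Omega" "u \<in> V" "g_Delta x u u = 0"
  shows "u = 0"
proof -
  have "dL x u = 0"
    using assms by (simp add: g_Delta_eq Q_root_eq_0)
  then show ?thesis
    using dE_dL[OF assms(1,2)] linear_0[OF linear_dE[OF Log_in_V[OF assms(1)]]] by simp
qed

text \<open>\<open>dL\<close> sends Gamma_nabla z u to d2L u z, so metric compatibility is the
  product rule for a fixed inner product, and torsion-freeness is the symmetry of
  \<open>d2L\<close>.\<close>

lemma levi_civita_Gamma_nabla: "levi_civita Gamma_nabla"
  unfolding levi_civita_def
proof (intro ballI conjI allI)
  fix x u w z assume x: "x \<in> Omega" and uwz: "u \<in> V" "w \<in> V" "z \<in> V"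
  show "Gamma_nabla x u w \<in> V"
    by (simp add: Gamma_nabla_eq x uwz)
  show "Gamma_nabla x (a *\<^sub>R u + b *\<^sub>R w) z = a *\<^sub>R Gamma_nabla x u z + b *\<^sub>R Gamma_nabla x w z" for a b
    using x uwz linear_d2L[OF x, of z] linear_dE[OF Log_in_V[OF x]]
    by (simp add: Gamma_nabla_eq subspace_V subspace_add subspace_scale linear_add linear_cmul)
  show "Gamma_nabla x u w = Gamma_nabla x w u"
    by (simp add: Gamma_nabla_eq x uwz d2L_sym[OF x])
  have "((\<lambda>p. Q_root (dL p u) \<bullet> Q_root (dL p w)) has_derivative
      (\<lambda>h. Q_root (dL x u) \<bullet> Q_root (d2L x w h) + Q_root (d2L x u h) \<bullet> Q_root (dL x w))) (at x within Omega)"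
    by (intro has_derivative_inner bounded_linear.has_derivative[OF bounded_linear_Q_root] dL_has_derivative x)
  then have "((\<lambda>p. g_Delta p u w) has_derivative
      (\<lambda>h. Q_root (dL x u) \<bullet> Q_root (d2L x w h) + Q_root (d2L x u h) \<bullet> Q_root (dL x w))) (at x within Omega)"
    by (rule has_derivative_transform[OF x, rotated]) (simp add: g_Delta_eq uwz)
  then have "frechet_derivative (\<lambda>p. g_Delta p u w) (at x within Omega) z
      = Q_root (dL x u) \<bullet> Q_root (d2L x w z) + Q_root (d2L x u z) \<bullet> Q_root (dL x w)"
    by (rule frechet_derivative_direction) (intro Omega_direction x uwz)
  then show "frechet_derivative (\<lambda>p. g_Delta p u w) (at x within Omega) z
      = g_Delta x (Gamma_nabla x z u) w + g_Delta x u (Gamma_nabla x z w)"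
    by (simp add: Gamma_nabla_eq g_Delta_eq x uwz dL_dE')
qed

lemma levi_civita_unique:
  assumes "levi_civita G" "levi_civita H" and x: "x \<in> Omega" and uw: "u \<in> V" "w \<in> V"
  shows "G x u w = H x u w"
proof -
  define A where "A u w = G x u w - H x u w" for u w
  have V: "G x u w \<in> V" "H x u w \<in> V" if "u \<in> V" "w \<in> V" for u w
    using assms(1,2)[unfolded levi_civita_def, rule_format, OF x that that(1)] by blast+
  have AV: "A u w \<in> V" if "u \<in> V" "w \<in> V" for u w
    using V that by (simp add: A_def subspace_V subspace_diff)
  have Asym: "A u w = A w u" if "u \<in> V" "w \<in> V" for u w
    using assms(1,2)[unfolded levi_civita_def, rule_format, OF x that that(1)] by (simp add: A_def)
  have gdiff: "g_Delta x (a - b) c = g_Delta x a c - g_Delta x b c"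
    if "a \<in> V" "b \<in> V" "c \<in> V" for a b c
    using that linear_diff[OF linear_dL[OF x]] bounded_linear.linear[OF bounded_linear_Q_root]
    by (simp add: g_Delta_eq x subspace_V subspace_diff linear_diff inner_diff_left)
  have gsym: "g_Delta x a b = g_Delta x b a" if "a \<in> V" "b \<in> V" for a b
    using that by (simp add: g_Delta_eq x inner_commute)
  have skew: "g_Delta x (A z u) w = - g_Delta x (A z w) u" if "u \<in> V" "w \<in> V" "z \<in> V" for u w z
  proof -
    have "g_Delta x (G x z u) w + g_Delta x u (G x z w) = g_Delta x (H x z u) w + g_Delta x u (H x z w)"
      using assms(1,2)[unfolded levi_civita_def, rule_format, OF x that] by simp
    then show ?thesis
      using that by (simp add: A_def gdiff V gsym[of u])
  qed
  text \<open>A trilinear form symmetric in the first two and skew in the last two arguments vanishes.\<close>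
  have "g_Delta x (A u w) z = 0" if "z \<in> V" for z
    using skew[OF uw(2) that uw(1)] skew[OF uw that] skew[OF that uw]
      Asym[OF uw(2,1)] Asym[OF that uw(2)] Asym[OF that uw(1)] by simp
  from this[OF AV[OF uw]] have "A u w = 0"
    by (intro g_Delta_self_eq_0[OF x AV[OF uw]])
  then show ?thesis
    by (simp add: A_def)
qed

text \<open>\<open>Gamma_nabla\<close> witnesses that the choice behind \<open>Gamma_LC\<close> has
  a candidate, and uniqueness identifies whatever was chosen.\<close>

lemma Gamma_LC_eq: "x \<in> Omega \<Longrightarrow> u \<in> V \<Longrightarrow> w \<in> V \<Longrightarrow> Gamma_LC x u w = Gamma_nabla x u w"
  unfolding Gamma_LC_def
  by (intro levi_civita_unique levi_civita_Gamma_nabla someI[of levi_civita, OF levi_civita_Gamma_nabla])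

section \<open>Geodesics as affine segments in the chart\<close>

lemma unit_interval_neq_bot: "t \<in> {0..1::real} \<Longrightarrow> at t within {0..1} \<noteq> bot"
  by (simp add: trivial_limit_within islimpt_Icc)

text \<open>The second derivative of the curve in the chart is the \<open>dL\<close> image of its
  covariant acceleration, so the geodesic equation says that the velocity in the chart is
  constant.\<close>

lemma Log_curve_accel:
  assumes c: "c ` {0..1} \<subseteq> Omega" and t: "t \<in> {0..1}"
    and c1: "\<And>t. t \<in> {0..1} \<Longrightarrow> (c has_vector_derivative c' t) (at t within {0..1})"
    and c2: "(c' has_vector_derivative c'') (at t within {0..1})"
  shows "((\<lambda>s. dL (c s) (c' s)) has_vector_derivative
           dL (c t) (c'' + Gamma_nabla (c t) (c' t) (c' t))) (at t within {0..1})"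
    and "c' t \<in> V" "c'' \<in> V"
proof -
  have V: "c ` {0..1} \<subseteq> V" using c Omega_subset_V by blast
  have c'V: "c' s \<in> V" if "s \<in> {0..1}" for s
    using V_valued_vector_derivative[OF c1[OF that] V that unit_interval_neq_bot[OF that]] .
  then show "c' t \<in> V" "c'' \<in> V"
    using V_valued_vector_derivative[OF c2 _ t unit_interval_neq_bot[OF t]] t by (blast intro: image_subsetI)+
  have ct: "c t \<in> Omega" using c t by auto
  have "dL (c t) (c'' + Gamma_nabla (c t) (c' t) (c' t)) = d2L (c t) (c' t) (c' t) + dL (c t) c''"
    using c'V[OF t] by (simp add: linear_add[OF linear_dL[OF ct]] Gamma_nabla_eq ct dL_dE')
  then show "((\<lambda>s. dL (c s) (c' s)) has_vector_derivative
           dL (c t) (c'' + Gamma_nabla (c t) (c' t) (c' t))) (at t within {0..1})"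
    using second_diff_on_curve[OF dL c t c1[OF t] c2] by simp
qed

lemma geodesic_imp_gamma_Delta:
  assumes "geodesic Gamma_nabla x y c" and t: "t \<in> {0..1}"
  shows "c t = gamma_Delta x y t"
proof -
  obtain c' c'' where c: "c ` {0..1} \<subseteq> Omega" and xy: "c 0 = x" "c 1 = y"
    and c1: "\<And>t. t \<in> {0..1} \<Longrightarrow> (c has_vector_derivative c' t) (at t within {0..1})"
    and c2: "\<And>t. t \<in> {0..1} \<Longrightarrow> (c' has_vector_derivative c'' t) (at t within {0..1})"
    and geo: "\<And>t. t \<in> {0..1} \<Longrightarrow> c'' t + Gamma_nabla (c t) (c' t) (c' t) = 0"
    using assms(1) unfolding geodesic_def by metis
  have cO: "c s \<in> Omega" if "s \<in> {0..1}" for s using c that by auto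
  have "((\<lambda>s. dL (c s) (c' s)) has_vector_derivative 0) (at t within {0..1})" if "t \<in> {0..1}" for t
    using Log_curve_accel(1)[OF c that c1 c2[OF that]] geo[OF that] linear_0[OF linear_dL[OF cO[OF that]]]
    by simp
  then obtain k where k: "\<And>t. t \<in> {0..1} \<Longrightarrow> dL (c t) (c' t) = k"
    using has_vector_derivative_zero_constant[of "{0..1}" "\<lambda>s. dL (c s) (c' s)"] by auto
  have "((\<lambda>s. Log_Delta (c s) - s *\<^sub>R k) has_vector_derivative 0) (at t within {0..1})" if "t \<in> {0..1}" for t
  proof -
    have "((\<lambda>s. Log_Delta (c s)) has_vector_derivative dL (c t) (c' t)) (at t within {0..1})"
      by (rule has_vector_derivative_compose_curve[OF Log_has_derivative[OF cO[OF that]] c c1[OF that]])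
    then show ?thesis
      unfolding k[OF that] by (auto intro!: derivative_eq_intros)
  qed
  then obtain l where l: "\<And>t. t \<in> {0..1} \<Longrightarrow> Log_Delta (c t) - t *\<^sub>R k = l"
    using has_vector_derivative_zero_constant[of "{0..1}" "\<lambda>s. Log_Delta (c s) - s *\<^sub>R k"] by auto
  have "l = Log_Delta x" "k = Log_Delta y - Log_Delta x"
    using l[of 0] l[of 1] xy by (auto simp: algebra_simps)
  moreover have "Log_Delta (c t) = l + t *\<^sub>R k"
    using l[OF t] by (simp add: algebra_simps)
  ultimately have "Log_Delta (c t) = (1 - t) *\<^sub>R Log_Delta x + t *\<^sub>R Log_Delta y"
    by (simp only:) (simp add: algebra_simps)
  then show ?thesis
    using Exp_Log[OF cO[OF t]] by (simp add: gamma_Delta_def)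
qed

lemma affine_Log_in_V:
  "x \<in> Omega \<Longrightarrow> y \<in> Omega \<Longrightarrow> (1 - t) *\<^sub>R Log_Delta x + t *\<^sub>R Log_Delta y \<in> V"
  by (simp add: Log_in_V subspace_V subspace_add subspace_scale)

lemma gamma_Delta_in_Omega: "x \<in> Omega \<Longrightarrow> y \<in> Omega \<Longrightarrow> gamma_Delta x y t \<in> Omega"
  by (simp add: gamma_Delta_def Exp_in_Omega affine_Log_in_V)

lemma Log_gamma_Delta:
  "x \<in> Omega \<Longrightarrow> y \<in> Omega \<Longrightarrow> Log_Delta (gamma_Delta x y t) = (1 - t) *\<^sub>R Log_Delta x + t *\<^sub>R Log_Delta y"
  by (simp add: gamma_Delta_def Log_Exp affine_Log_in_V)

lemma gamma_Delta_0: "x \<in> Omega \<Longrightarrow> gamma_Delta x y 0 = x"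
  and gamma_Delta_1: "y \<in> Omega \<Longrightarrow> gamma_Delta x y 1 = y"
  by (simp_all add: gamma_Delta_def Exp_Log)

lemma affine_has_vector_derivative:
  "((\<lambda>t. (1 - t) *\<^sub>R a + t *\<^sub>R b) has_vector_derivative b - a) (at t within I)"
  by (auto intro!: derivative_eq_intros)

lemma gamma_Delta_has_vector_derivative:
  assumes "x \<in> Omega" "y \<in> Omega"
  defines "v \<equiv> \<lambda>t. (1 - t) *\<^sub>R Log_Delta x + t *\<^sub>R Log_Delta y"
  shows "(gamma_Delta x y has_vector_derivative dE (v t) (Log_Delta y - Log_Delta x)) (at t within I)"
    and "((\<lambda>t. dE (v t) (Log_Delta y - Log_Delta x)) has_vector_derivative
       d2E (v t) (Log_Delta y - Log_Delta x) (Log_Delta y - Log_Delta x)) (at t within I)"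
proof -
  have vV: "v t \<in> V" for t using assms affine_Log_in_V by (simp add: v_def)
  then have vI: "v ` UNIV \<subseteq> V" by auto
  have v1: "(v has_vector_derivative Log_Delta y - Log_Delta x) (at t)" for t
    unfolding v_def by (rule affine_has_vector_derivative)
  have "((\<lambda>s. Exp_Delta (v s)) has_vector_derivative dE (v t) (Log_Delta y - Log_Delta x)) (at t)"
    by (rule has_vector_derivative_compose_curve[OF Exp_has_derivative[OF vV] vI v1])
  then show "(gamma_Delta x y has_vector_derivative dE (v t) (Log_Delta y - Log_Delta x)) (at t within I)"
    unfolding gamma_Delta_def[abs_def] v_def by (rule has_vector_derivative_at_within)
  have "((\<lambda>t. dE (v t) (Log_Delta y - Log_Delta x)) has_vector_derivative
       d2E (v t) (Log_Delta y - Log_Delta x) (Log_Delta y - Log_Delta x) + dE (v t) 0) (at t)"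
    by (rule second_diff_on_curve[OF dE vI UNIV_I v1]) (auto intro!: derivative_eq_intros)
  then show "((\<lambda>t. dE (v t) (Log_Delta y - Log_Delta x)) has_vector_derivative
       d2E (v t) (Log_Delta y - Log_Delta x) (Log_Delta y - Log_Delta x)) (at t within I)"
    using linear_0[OF linear_dE[OF vV]] by (simp add: has_vector_derivative_at_within)
qed

text \<open>The velocity in the chart is the constant k, so \<open>dL\<close> of the covariant
  acceleration is 0. The acceleration lies in \<open>V\<close>, where \<open>dL\<close> is
  injective, and hence vanishes.\<close>

lemma geodesic_gamma_Delta:
  assumes xy: "x \<in> Omega" "y \<in> Omega"
  shows "geodesic Gamma_nabla x y (gamma_Delta x y)"
proof -
  define v where "v = (\<lambda>t. (1 - t) *\<^sub>R Log_Delta x + t *\<^sub>R Log_Delta y)"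
  define k where "k = Log_Delta y - Log_Delta x"
  define c c' c'' where "c = gamma_Delta x y" and "c' = (\<lambda>t. dE (v t) k)" and "c'' = (\<lambda>t. d2E (v t) k k)"
  have kV: "k \<in> V" using xy Log_in_V by (simp add: k_def subspace_V subspace_diff)
  have vV: "v t \<in> V" for t using xy affine_Log_in_V by (simp add: v_def)
  have c1: "(c has_vector_derivative c' t) (at t within {0..1})"
    and c2: "(c' has_vector_derivative c'' t) (at t within {0..1})" for t
    unfolding c_def c'_def c''_def v_def k_def by (rule gamma_Delta_has_vector_derivative[OF xy])+
  have cO: "c t \<in> Omega" for t using gamma_Delta_in_Omega[OF xy] by (simp add: c_def)
  have cE: "c t = Exp_Delta (v t)" for t by (simp add: c_def gamma_Delta_def v_def)
  have "c'' t + Gamma_nabla (c t) (c' t) (c' t) = 0" if t: "t \<in> {0..1}" for t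
  proof -
    let ?a = "c'' t + Gamma_nabla (c t) (c' t) (c' t)"
    have "((\<lambda>s. dL (c s) (c' s)) has_vector_derivative dL (c t) ?a) (at t within {0..1})"
      using Log_curve_accel(1)[OF _ t c1 c2] cO by blast
    moreover have "dL (c s) (c' s) = k" for s
      by (simp add: c'_def cE dL_dE vV kV)
    ultimately have "dL (c t) ?a = 0"
      using vector_derivative_unique_within[OF unit_interval_neq_bot[OF t] _ has_vector_derivative_const]
      by simp
    moreover have "?a \<in> V"
      by (simp add: Gamma_nabla_eq cO c'_def c''_def subspace_V subspace_add)
    ultimately show ?thesis
      using dE_dL[OF cO, of ?a t] linear_0[OF linear_dE[OF Log_in_V[OF cO]]] by simp
  qed
  with c1 c2 have "\<exists>c' c''. \<forall>t\<in>{0..1}. (c has_vector_derivative c' t) (at t within {0..1}) \<and>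
      (c' has_vector_derivative c'' t) (at t within {0..1}) \<and> c'' t + Gamma_nabla (c t) (c' t) (c' t) = 0"
    by blast
  moreover have "c ` {0..1} \<subseteq> Omega" "c 0 = x" "c 1 = y"
    using cO by (auto simp: c_def gamma_Delta_0 gamma_Delta_1 xy)
  ultimately show ?thesis
    by (simp add: geodesic_def flip: c_def)
qed

text \<open>Agreement of the two symbols is known on \<open>V\<close> only; velocities of curves in
  the cone lie there.\<close>

lemma geodesic_Gamma_LC_iff: "geodesic Gamma_LC x y c \<longleftrightarrow> geodesic Gamma_nabla x y c"
proof -
  have "Gamma_LC (c t) (c' t) (c' t) = Gamma_nabla (c t) (c' t) (c' t)"
    if "c ` {0..1} \<subseteq> Omega" "t \<in> {0..1}" "(c has_vector_derivative c' t) (at t within {0..1})" for c' t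
  proof -
    have "c' t \<in> V"
      using V_valued_vector_derivative[OF that(3) _ that(2) unit_interval_neq_bot[OF that(2)]] that(1)
        Omega_subset_V by blast
    then show ?thesis
      using that by (intro Gamma_LC_eq) auto
  qed
  then show ?thesis
    unfolding geodesic_def by (metis (no_types, lifting))
qed

lemma unique_geodesic_gamma_Delta:
  assumes "x \<in> Omega" "y \<in> Omega"
  shows "unique_geodesic Gamma_nabla x y (gamma_Delta x y)"
    and "unique_geodesic Gamma_LC x y (gamma_Delta x y)"
  using geodesic_gamma_Delta[OF assms] geodesic_imp_gamma_Delta
  by (auto simp: unique_geodesic_def geodesic_Gamma_LC_iff)

end

subsection \<open>Lengths and distances\<close>

context log_chart
begin

text \<open>Basis expansion again reduces joint continuity of \<open>dL\<close> to continuity for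
  fixed directions.\<close>

lemma continuous_on_dL_curve:
  assumes c: "c ` I \<subseteq> Omega" "continuous_on I c" "continuous_on I c'"
  shows "continuous_on I (\<lambda>t. dL (c t) (c' t))"
proof -
  have "continuous_on Omega (\<lambda>x. dL x b)" for b
    by (rule has_derivative_continuous_on) (rule dL_has_derivative)
  then have "continuous_on I (\<lambda>t. dL (c t) b)" for b
    using continuous_on_compose2 c(1,2) by blast
  then have "continuous_on I (\<lambda>t. \<Sum>b\<in>Basis. (c' t \<bullet> b) *\<^sub>R dL (c t) b)"
    using c by (intro continuous_intros)
  moreover have "(\<Sum>b\<in>Basis. (c' t \<bullet> b) *\<^sub>R dL (c t) b) = dL (c t) (c' t)" if "t \<in> I" for t
    using c that by (intro linear_sum_Basis linear_dL) auto
  ultimately show ?thesis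
    by (simp cong: continuous_on_cong)
qed

lemma g_Delta_norm: "x \<in> Omega \<Longrightarrow> u \<in> V \<Longrightarrow> sqrt (g_Delta x u u) = norm (Q_root (dL x u))"
  by (simp add: g_Delta_eq norm_eq_sqrt_inner)

text \<open>The integrand is the speed of R, the curve transported by the logarithm and
  \<open>Q_root\<close>, so the bound is the Euclidean one between its endpoints.\<close>

lemma curve_length_ge:
  assumes c: "piecewise_C1_curve c" "c ` {0..1} \<subseteq> Omega"
  shows "norm (Q_root (Log_Delta (c 1)) - Q_root (Log_Delta (c 0))) \<le> curve_length c 0 1"
proof -
  define G where "G t = (let v = vector_derivative c (at t within {0..1}) in sqrt (g_Delta (c t) v v))" for t
  define R where "R t = Q_root (Log_Delta (c t))" for t
  obtain n \<tau> where \<tau>: "\<tau> 0 = (0::real)" "\<tau> n = 1" "\<And>i. i < n \<Longrightarrow> \<tau> i < \<tau> (Suc i)"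
    and C1: "\<And>i. i < n \<Longrightarrow> C1_curve_on (\<tau> i) (\<tau> (Suc i)) c"
    using c(1) unfolding piecewise_C1_curve_def by blast
  have mono: "\<tau> i \<le> \<tau> j" if "i \<le> j" "j \<le> n" for i j
    using that
  proof (induction rule: dec_induct)
    case (step k)
    then show ?case using \<tau>(3)[of k] by simp
  qed simp
  \<comment> \<open>The induction over the pieces carries existence of the integral as well, since
    \<open>integral\<close> has a default value for a function that is not integrable.\<close>
  have "\<exists>I. (G has_integral I) {0..\<tau> i} \<and> norm (R (\<tau> i) - R 0) \<le> I" if "i \<le> n" for i
    using that
  proof (induction i)
    case 0
    show ?case using has_integral_refl(2)[of G 0] \<tau>(1) by (intro exI[of _ 0]) simp
  next
    case (Suc i)
    let ?a = "\<tau> i" and ?b = "\<tau> (Suc i)"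
    have ab: "0 \<le> ?a" "?a < ?b" "?b \<le> 1"
      using mono[of 0 i] mono[of "Suc i" n] \<tau> Suc.prems by auto
    have cab: "c ` {?a..?b} \<subseteq> Omega"
      using c(2) ab by (fastforce simp: image_subset_iff)
    obtain c' where c': "continuous_on {?a..?b} c'"
      "\<And>t. t \<in> {?a..?b} \<Longrightarrow> (c has_vector_derivative c' t) (at t within {?a..?b})"
      using C1[of i] Suc.prems unfolding C1_curve_on_def by auto
    have cont: "continuous_on {?a..?b} c"
      using c'(2) has_vector_derivative_continuous continuous_on_eq_continuous_within by blast
    define h where "h t = Q_root (dL (c t) (c' t))" for t
    have hcont: "continuous_on {?a..?b} h"
      unfolding h_def
      by (intro bounded_linear.continuous_on[OF bounded_linear_Q_root] continuous_on_dL_curve cab cont c'(1))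
    have "(R has_vector_derivative h t) (at t within {?a..?b})" if "t \<in> {?a..?b}" for t
    proof -
      have "c t \<in> Omega" using cab that by blast
      then show ?thesis
        unfolding R_def h_def
        by (intro bounded_linear.has_vector_derivative[OF bounded_linear_Q_root]
            has_vector_derivative_compose_curve[OF Log_has_derivative cab] c'(2) that)
    qed
    then have int: "(h has_integral R ?b - R ?a) {?a..?b}"
      using ab by (intro fundamental_theorem_of_calculus) simp_all
    have nint: "((\<lambda>t. norm (h t)) has_integral integral {?a..?b} (\<lambda>t. norm (h t))) {?a..?b}"
      by (intro integrable_integral integrable_continuous_interval continuous_intros hcont)
    have le: "norm (R ?b - R ?a) \<le> integral {?a..?b} (\<lambda>t. norm (h t))"
      using integral_norm_bound_integral[of h "{?a..?b}" "\<lambda>t. norm (h t)"] int nint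
      by (metis has_integral_integrable integral_unique order_refl)
    \<comment> \<open>G differentiates within {0..1}, where a break point may admit no derivative.
      Dropping the endpoints of the piece avoids this; at interior points both filters are
      \<open>at t\<close>.\<close>
    have "(G has_integral integral {?a..?b} (\<lambda>t. norm (h t))) {?a..?b}"
    proof (rule has_integral_spike_finite[OF _ _ nint])
      show "finite {?a, ?b}" by simp
      fix t assume "t \<in> {?a..?b} - {?a, ?b}"
      then have t: "?a < t" "t < ?b" by auto
      have at: "at t within {?a..?b} = at t" "at t within {0..1} = at t"
        using t ab by (simp_all add: at_within_Icc_at)
      have der: "(c has_vector_derivative c' t) (at t)"
        using c'(2)[of t] t at by simp
      have "c' t \<in> V"
        using V_valued_vector_derivative[OF c'(2)[of t], of] cab Omega_subset_V t at by auto
      then show "G t = norm (h t)"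
        using cab t by (simp add: G_def at vector_derivative_at[OF der] h_def g_Delta_norm image_subset_iff)
    qed
    moreover obtain I where I: "(G has_integral I) {0..?a}" "norm (R ?a - R 0) \<le> I"
      using Suc by auto
    ultimately have "(G has_integral (I + integral {?a..?b} (\<lambda>t. norm (h t)))) {0..?b}"
      using ab by (intro has_integral_combine[of 0 ?a ?b]) auto
    moreover have "norm (R ?b - R 0) \<le> I + integral {?a..?b} (\<lambda>t. norm (h t))"
      using norm_triangle_ineq[of "R ?b - R ?a" "R ?a - R 0"] I(2) le by simp
    ultimately show ?case by blast
  qed
  from this[of n] obtain I where "(G has_integral I) {0..1}" "norm (R 1 - R 0) \<le> I"
    using \<tau> by auto
  then show ?thesis
    unfolding curve_length_def G_def[symmetric] R_def[symmetric] by (simp add: integral_unique)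
qed

lemma curve_length_gamma_Delta:
  assumes xy: "x \<in> Omega" "y \<in> Omega" and "a \<le> b"
  shows "curve_length (gamma_Delta x y) a b = (b - a) * norm (Q_root (Log_Delta y - Log_Delta x))"
\<comment> \<open>On a degenerate interval the vector derivative is undetermined, but both sides are
  0.\<close>
proof (cases "a = b")
  case False
  let ?k = "Log_Delta y - Log_Delta x"
  let ?v = "\<lambda>t. (1 - t) *\<^sub>R Log_Delta x + t *\<^sub>R Log_Delta y"
  have kV: "?k \<in> V" using xy Log_in_V by (simp add: subspace_V subspace_diff)
  have ab: "a < b" using False assms by simp
  have "sqrt (g_Delta (gamma_Delta x y t) v v) = norm (Q_root ?k)"
    if "t \<in> {a..b}" "v = vector_derivative (gamma_Delta x y) (at t within {a..b})" for t v
  proof -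
    have "v = dE (?v t) ?k"
      using that ab gamma_Delta_has_vector_derivative(1)[OF xy, of t "{a..b}"]
      by (simp add: vector_derivative_within_cbox[of a b, simplified])
    then show ?thesis
      using gamma_Delta_in_Omega[OF xy] dL_dE[OF affine_Log_in_V[OF xy] kV]
      by (simp add: g_Delta_norm gamma_Delta_def)
  qed
  then have "curve_length (gamma_Delta x y) a b = integral {a..b} (\<lambda>t. norm (Q_root ?k))"
    unfolding curve_length_def Let_def by (intro integral_cong) blast
  then show ?thesis
    using ab by simp
qed (simp add: curve_length_def)

lemma piecewise_C1_gamma_Delta:
  assumes xy: "x \<in> Omega" "y \<in> Omega"
  shows "piecewise_C1_curve (gamma_Delta x y)"
proof -
  have "C1_curve_on 0 1 (gamma_Delta x y)"
    unfolding C1_curve_on_def continuous_on_eq_continuous_within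
    by (rule exI[of _ "\<lambda>t. dE ((1 - t) *\<^sub>R Log_Delta x + t *\<^sub>R Log_Delta y) (Log_Delta y - Log_Delta x)"])
      (intro conjI ballI gamma_Delta_has_vector_derivative(1)[OF xy]
        has_vector_derivative_continuous[OF gamma_Delta_has_vector_derivative(2)[OF xy]])
  then show ?thesis
    unfolding piecewise_C1_curve_def by (intro exI[of _ 1] exI[of _ real]) simp
qed

text \<open>\<open>curve_length_ge\<close> bounds every competitor and \<open>gamma_Delta\<close>
  attains the bound, so the infimum is a minimum.\<close>

lemma d_Delta_eq:
  assumes xy: "x \<in> Omega" "y \<in> Omega"
  shows "d_Delta x y = norm (Q_root (Log_Delta y - Log_Delta x))"
  unfolding d_Delta_def
proof (rule cInf_eq_minimum)
  have "curve_length (gamma_Delta x y) 0 1 = norm (Q_root (Log_Delta y - Log_Delta x))"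
    by (simp add: curve_length_gamma_Delta xy)
  then show "norm (Q_root (Log_Delta y - Log_Delta x)) \<in> {curve_length c 0 1 |c.
      piecewise_C1_curve c \<and> c ` {0..1} \<subseteq> Omega \<and> c 0 = x \<and> c 1 = y}"
    using piecewise_C1_gamma_Delta[OF xy] gamma_Delta_in_Omega[OF xy]
    by (intro CollectI exI[of _ "gamma_Delta x y"]) (auto simp: gamma_Delta_0 gamma_Delta_1 xy)
  fix l assume "l \<in> {curve_length c 0 1 |c.
      piecewise_C1_curve c \<and> c ` {0..1} \<subseteq> Omega \<and> c 0 = x \<and> c 1 = y}"
  then show "norm (Q_root (Log_Delta y - Log_Delta x)) \<le> l"
    using curve_length_ge by (auto simp: linear_diff bounded_linear.linear[OF bounded_linear_Q_root])
qed

lemma d_Delta_gamma_Delta: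
  assumes xy: "x \<in> Omega" "y \<in> Omega" and t: "t \<in> {0..1}"
  shows "d_Delta x (gamma_Delta x y t) = t * d_Delta x y"
    and "d_Delta y (gamma_Delta x y t) = (1 - t) * d_Delta x y"
proof -
  note Q = linear_cmul[OF bounded_linear.linear[OF bounded_linear_Q_root]]
  let ?k = "Log_Delta y - Log_Delta x"
  have "Log_Delta (gamma_Delta x y t) - Log_Delta x = t *\<^sub>R ?k"
    "Log_Delta (gamma_Delta x y t) - Log_Delta y = (t - 1) *\<^sub>R ?k"
    by (simp_all add: Log_gamma_Delta xy algebra_simps)
  then show "d_Delta x (gamma_Delta x y t) = t * d_Delta x y"
    "d_Delta y (gamma_Delta x y t) = (1 - t) * d_Delta x y"
    using t by (simp_all add: d_Delta_eq xy gamma_Delta_in_Omega Q)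
qed

lemma midpoint_of_gamma_Delta_iff:
  assumes xy: "x \<in> Omega" "y \<in> Omega"
  shows "midpoint_of_curve (gamma_Delta x y) m \<longleftrightarrow> m = LV_mean x y"
proof
  let ?k = "Log_Delta y - Log_Delta x"
  assume "midpoint_of_curve (gamma_Delta x y) m"
  then obtain s where "s \<in> {0..1}" and m: "gamma_Delta x y s = m"
    and "curve_length (gamma_Delta x y) 0 s = curve_length (gamma_Delta x y) s 1"
    unfolding midpoint_of_curve_def by blast
  then have s: "s * norm (Q_root ?k) = (1 - s) * norm (Q_root ?k)"
    by (simp only: curve_length_gamma_Delta[OF xy] atLeastAtMost_iff diff_zero)
  show "m = LV_mean x y"
  \<comment> \<open>If the length vanishes, every s satisfies the equation; the two logarithms then
    coincide and the curve is constant, so the point is still unique.\<close>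
  proof (cases "norm (Q_root ?k) = 0")
    case True
    then have "?k = 0"
      using Q_root_eq_0[of ?k] xy Log_in_V by (simp add: subspace_V subspace_diff)
    then have "Log_Delta y = Log_Delta x"
      by simp
    then show ?thesis
      using m by (simp add: LV_mean_def gamma_Delta_def flip: scaleR_left_distrib)
  next
    case False
    then have "s = 1 - s"
      using s by (simp only: mult_cancel_right) simp
    then have "s = 1 / 2" by simp
    with m show ?thesis
      unfolding LV_mean_def by blast
  qed
next
  assume "m = LV_mean x y"
  then show "midpoint_of_curve (gamma_Delta x y) m"
    unfolding midpoint_of_curve_def
    by (intro bexI[of _ "1/2"]) (simp_all add: LV_mean_def curve_length_gamma_Delta xy)
qed

end

theorem theorem7p9:
  fixes x y :: "real^3^3"
  assumes "x \<in> Omega" and "y \<in> Omega"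
  shows "unique_geodesic Gamma_nabla x y (gamma_Delta x y)
    \<and> unique_geodesic Gamma_LC x y (gamma_Delta x y)
    \<and> (\<forall>m. midpoint_of_curve (gamma_Delta x y) m \<longleftrightarrow> m = LV_mean x y)
    \<and> (\<forall>t\<in>{0..1}.
          d_Delta x (gamma_Delta x y t) = t * d_Delta x y
        \<and> d_Delta y (gamma_Delta x y t) = (1 - t) * d_Delta x y)
    \<and> d_Delta x (LV_mean x y) = d_Delta x y / 2
    \<and> d_Delta y (LV_mean x y) = d_Delta x y / 2"
proof -
  obtain dL d2L dE d2E where "log_chart dL d2L dE d2E"
    using log_chart_exists by blast
  then interpret log_chart dL d2L dE d2E .
  have "d_Delta x (LV_mean x y) = d_Delta x y / 2" "d_Delta y (LV_mean x y) = d_Delta x y / 2"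
    using d_Delta_gamma_Delta[OF assms, of "1/2"] by (simp_all add: LV_mean_def)
  then show ?thesis
    using unique_geodesic_gamma_Delta[OF assms] midpoint_of_gamma_Delta_iff[OF assms]
      d_Delta_gamma_Delta[OF assms] by blast
qed

end
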